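(* (i) $\mathbb E=\mathbb M_\gamma(\mathtt{ta^+})$. (ii) $\overline{\mathbb E}=\mathbb M_\gamma(\mathtt{a^+t})$. (iii) $\mathbb E\vee\overline{\mathbb E}=\mathbb B_0=\mathbb M_\gamma(\mathtt{ta^+},\mathtt{a^+t})=\mathbb M_\gamma(\mathtt{a^+ta^+})$. (iv) $\mathbb A_0=\mathbb M_\gamma(\mathtt{a^+b^+})$.
   Context: Monoids are regarded as semigroups with an additional nullary operation fixing the identity element; varieties are varieties of monoids, $\vee$ is the join of varieties, and $\overline{\mathbb V}$ denotes the variety dual to $\mathbb V$, i.e. consisting of all monoids anti-isomorphic to monoids of $\mathbb V$. For a semigroup $S$, $S^1$ is the monoid obtained by adjoining an identity element. Let $E=\langle e,c\mid e^2=e,\ c^2=ec=0,\ ce=c\rangle$, $B_0=\langle e,f,c\mid e^2=e,\ f^2=f,\ ef=fe=0,\ ec=cf=c\rangle$, $A_0=\langle e,f\mid e^2=e,\ f^2=f,\ ef=0\rangle$ (semigroups with zero $0$), and let $\mathbb E$, $\mathbb B_0$, $\mathbb A_0$ be the monoid varieties generated by $E^1$, $B_0^1$, $A_0^1$ respectively. Let $\mathfrak A$ be a countably infinite alphabet, $\mathfrak A^*$ the free monoid over it; $a,b,t$ are distinct letters. A letter is multiple in a word if it occurs in it at least twice; $\operatorname{mul}(\mathbf u)$ is the set of multiple letters of $\mathbf u$. Let $\tau_1$ be the congruence on $\mathfrak A^*$ generated by the relations $a=a^2$, $a\in\mathfrak A$. The congruence $\gamma$ is given by: $\mathbf u\,\gamma\,\mathbf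 v$ iff $\mathbf u\,\tau_1\,\mathbf v$ and $\operatorname{mul}(\mathbf u)=\operatorname{mul}(\mathbf v)$. In $\mathfrak A^*/\gamma$ write $\mathtt a=\{a\}$ and $\mathtt a^+=\{a^n\mid n\ge 2\}$ for each letter $a$; juxtaposition of such symbols denotes the product in $\mathfrak A^*/\gamma$. Thus $\mathtt{ta^+}=\{ta^n\mid n\ge2\}$, $\mathtt{a^+t}=\{a^nt\mid n\ge2\}$, $\mathtt{a^+ta^+}=\{a^nta^m\mid n,m\ge1\}$, $\mathtt{a^+b^+}=\{a^nb^m\mid n,m\ge2\}$. For a congruence $\tau$ on $\mathfrak A^*$ and $\tau$-classes $\mathtt u,\mathtt v$, write $\mathtt v\le_\tau\mathtt u$ if $\mathtt u=\mathtt p\,\mathtt v\,\mathtt s$ in $\mathfrak A^*/\tau$ for some $\mathtt p,\mathtt s\in\mathfrak A^*/\tau$. For a set $\mathtt W\subseteq\mathfrak A^*/\tau$ let $\mathtt W^{\le_\tau}=\{\mathtt v\mid \mathtt v\le_\tau\mathtt u \text{ for some }\mathtt u\in\mathtt W\}$, and let $M_\tau(\mathtt W)$ be the Rees quotient of $\mathfrak A^*/\tau$ over the ideal $(\mathfrak A^*/\tau)\setminus\mathtt W^{\le_\tau}$, i.e. the monoid $\mathtt W^{\le_\tau}\cup\{0\}$ in which the product of $\mathtt u,\mathtt v\in \mathtt W^{\le_\tau}$ is their product in $\mathfrak A^*/\tau$ if that lies in $\mathtt W^{\le_\tau}$, and all other products are $0$. $\mathbb M_\tau(\mathtt w_1,\dots,\mathtt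 w_k)$ denotes the monoid variety generated by $M_\tau(\{\mathtt w_1,\dots,\mathtt w_k\})$. *)

theory Defs
  imports
    "HOL-Algebra.Product_Groups"
    "HOL-Library.Countable"
    "HOL-Library.Infinite_Typeclass"
begin

text \<open>
  A variety is represented by its members with carrier in an arbitrary infinite type \<open>'x\<close>.
  Since every variety is generated by its countable members, such a trace determines the variety,
  and inclusions, joins and duals can be computed on traces.

  A product of nontrivial members need not fit into \<open>'x\<close>, so closure under direct
  products, submonoids and homomorphic images is stated in one step: every monoid over \<open>'x\<close>
  that is a homomorphic image of a submonoid of a direct product of members is a member.
  Index sets \<open>I :: 'x set\<close> are enough: if \<open>N\<close> over \<open>'x\<close> is an image of a submonoid of any
  product, it is already an image of a submonoid with at most \<open>card 'x\<close> elements, and at most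
  \<open>card 'x\<close> coordinates separate these.
\<close>

definition monoid_variety :: "'x::infinite monoid set \<Rightarrow> bool" where
  "monoid_variety V \<longleftrightarrow>
     (\<forall>N\<in>V. monoid N) \<and>
     (\<forall>(I :: 'x set) M S N \<phi>.
        (\<forall>i\<in>I. M i \<in> V) \<and>
        submonoid S (product_group I M) \<and>
        monoid N \<and>
        \<phi> \<in> epi ((product_group I M)\<lparr>carrier := S\<rparr>) N \<and>
        \<phi> \<one>\<^bsub>product_group I M\<^esub> = \<one>\<^bsub>N\<^esub>
        \<longrightarrow> N \<in> V)"

text \<open>
  The generator may live in another type, so it is its isomorphic copies over \<open>'x\<close> that are
  required to belong to the variety. This is meant for generators having such a copy; finite
  ones always do, \<open>'x\<close> being infinite.
\<close>

definition generated_variety :: "'g monoid \<Rightarrow> 'x::infinite monoid set" where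
  "generated_variety G =
     \<Inter>{V. monoid_variety V \<and> (\<forall>N. monoid N \<and> N \<cong> G \<longrightarrow> N \<in> V)}"

definition variety_join ::
    "'x::infinite monoid set \<Rightarrow> 'x monoid set \<Rightarrow> 'x monoid set" where
  "variety_join V W = \<Inter>{U. monoid_variety U \<and> V \<union> W \<subseteq> U}"

definition opposite_monoid :: "'g monoid \<Rightarrow> 'g monoid" where
  "opposite_monoid M = M\<lparr>monoid.mult := (\<lambda>x y. y \<otimes>\<^bsub>M\<^esub> x)\<rparr>"

definition dual_variety :: "'x::infinite monoid set \<Rightarrow> 'x monoid set" where
  "dual_variety V = {N. monoid N \<and> (\<exists>M\<in>V. N \<cong> opposite_monoid M)}"

inductive_set generated_congruence ::
    "('l list \<times> 'l list) set \<Rightarrow> ('l list \<times> 'l list) set"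
  for R :: "('l list \<times> 'l list) set" where
  base: "(u, v) \<in> R \<Longrightarrow> (p @ u @ s, p @ v @ s) \<in> generated_congruence R"
| refl: "(u, u) \<in> generated_congruence R"
| sym: "(u, v) \<in> generated_congruence R \<Longrightarrow> (v, u) \<in> generated_congruence R"
| trans: "(u, v) \<in> generated_congruence R \<Longrightarrow> (v, w) \<in> generated_congruence R
    \<Longrightarrow> (u, w) \<in> generated_congruence R"

definition class_mult ::
    "('l list \<times> 'l list) set \<Rightarrow> 'l list set \<Rightarrow> 'l list set \<Rightarrow> 'l list set" where
  "class_mult \<tau> A B = (\<Union>u\<in>A. \<Union>v\<in>B. \<tau> `` {u @ v})"

type_synonym 'g semigroup_data = "'g set \<times> ('g \<Rightarrow> 'g \<Rightarrow> 'g)"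

definition adjoin_one :: "'g semigroup_data \<Rightarrow> 'g option monoid" where
  "adjoin_one S =
     \<lparr>carrier = insert None (Some ` fst S),
      monoid.mult = (\<lambda>x y. case x of None \<Rightarrow> y | Some x' \<Rightarrow>
        (case y of None \<Rightarrow> x | Some y' \<Rightarrow> Some (snd S x' y'))),
      one = None\<rparr>"

datatype 'g with_zero = Zero | Gen 'g

text \<open>
  The semigroup with zero presented by the generators \<open>'g\<close> and the relations \<open>R\<close>: the symbol
  \<open>0\<close> is an additional generator, and the relations making it a zero are added to \<open>R\<close>. The free
  semigroup consists of the nonempty words; \<open>R\<close> must relate nonempty words only.
\<close>

definition zero_relations :: "('g with_zero list \<times> 'g with_zero list) set" where
  "zero_relations =
     (\<Union>x. {([Zero, x], [Zero])}) \<union> (\<Union>x. {([x, Zero], [Zero])})"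

definition presented_semigroup ::
    "('g with_zero list \<times> 'g with_zero list) set \<Rightarrow> 'g with_zero list set semigroup_data" where
  "presented_semigroup R =
     (let \<theta> = generated_congruence (R \<union> zero_relations)
      in ({w. w \<noteq> []} // \<theta>, class_mult \<theta>))"

datatype gens_E = E_e | E_c
datatype gens_B0 = B0_e | B0_f | B0_c
datatype gens_A0 = A0_e | A0_f

definition semigroup_E :: "gens_E with_zero list set semigroup_data" where
  "semigroup_E =
     (let e = Gen E_e; c = Gen E_c; z = Zero
      in presented_semigroup
        {([e, e], [e]), ([c, c], [z]), ([e, c], [z]), ([c, e], [c])})"

definition semigroup_B0 :: "gens_B0 with_zero list set semigroup_data" where
  "semigroup_B0 =
     (let e = Gen B0_e; f = Gen B0_f; c = Gen B0_c; z = Zero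
      in presented_semigroup
        {([e, e], [e]), ([f, f], [f]), ([e, f], [z]), ([f, e], [z]),
         ([e, c], [c]), ([c, f], [c])})"

definition semigroup_A0 :: "gens_A0 with_zero list set semigroup_data" where
  "semigroup_A0 =
     (let e = Gen A0_e; f = Gen A0_f; z = Zero
      in presented_semigroup {([e, e], [e]), ([f, f], [f]), ([e, f], [z])})"

definition variety_E :: "'x::infinite monoid set" where
  "variety_E = generated_variety (adjoin_one semigroup_E)"

definition variety_B0 :: "'x::infinite monoid set" where
  "variety_B0 = generated_variety (adjoin_one semigroup_B0)"

definition variety_A0 :: "'x::infinite monoid set" where
  "variety_A0 = generated_variety (adjoin_one semigroup_A0)"

definition multiple_letters :: "'l list \<Rightarrow> 'l set" where
  "multiple_letters u = {x. count_list u x \<ge> 2}"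

definition tau1 :: "('l list \<times> 'l list) set" where
  "tau1 = generated_congruence {([x], [x, x]) | x. True}"

definition gamma :: "('l list \<times> 'l list) set" where
  "gamma = {(u, v). (u, v) \<in> tau1 \<and> multiple_letters u = multiple_letters v}"

definition class_letter :: "'l \<Rightarrow> 'l list set" where
  "class_letter x = {[x]}"

definition class_plus :: "'l \<Rightarrow> 'l list set" where
  "class_plus x = {replicate n x | n. n \<ge> 2}"

abbreviation gamma_mult :: "'l list set \<Rightarrow> 'l list set \<Rightarrow> 'l list set" (infixl \<open>\<cdot>\<^sub>\<gamma>\<close> 70)
  where "A \<cdot>\<^sub>\<gamma> B \<equiv> class_mult gamma A B"

definition factor_closure ::
    "('l list \<times> 'l list) set \<Rightarrow> 'l list set set \<Rightarrow> 'l list set set" where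
  "factor_closure \<tau> W =
     {v \<in> UNIV // \<tau>. \<exists>u\<in>W. \<exists>p \<in> UNIV // \<tau>. \<exists>s \<in> UNIV // \<tau>.
        u = class_mult \<tau> (class_mult \<tau> p v) s}"

text \<open>
  \<open>None\<close> is the zero of the Rees quotient. The identity is the class of the empty word, which
  lies in the factor closure unless \<open>W\<close> is empty.
\<close>

definition M_monoid ::
    "('l list \<times> 'l list) set \<Rightarrow> 'l list set set \<Rightarrow> 'l list set option monoid" where
  "M_monoid \<tau> W =
     (let D = factor_closure \<tau> W; bar = (\<lambda>A. if A \<in> D then Some A else None)
      in \<lparr>carrier = insert None (Some ` D),
          monoid.mult = (\<lambda>x y. case x of None \<Rightarrow> None | Some u \<Rightarrow>
            (case y of None \<Rightarrow> None | Some v \<Rightarrow> bar (class_mult \<tau> u v))),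
          one = bar (\<tau> `` {[]})\<rparr>)"

definition variety_M ::
    "('l list \<times> 'l list) set \<Rightarrow> 'l list set set \<Rightarrow> 'x::infinite monoid set" where
  "variety_M \<tau> W = generated_variety (M_monoid \<tau> W)"

end

theory Submission
  imports Defs
begin

text \<open>
  A monoid lies in the variety generated by some monoids as soon as it is an image of a monoid \<open>P\<close>
  by a map whose kernel contains the common kernel of homomorphisms from \<open>P\<close> to these monoids.
  Taking \<open>P\<close> free, every inclusion between two of the varieties becomes a statement about the values
  of words under assignments of letters. The value of a word in \<open>E\<^sup>1\<close> under \<open>t \<mapsto> c\<close>, \<open>a \<mapsto> e\<close> is
  nonzero iff the word is a factor of some \<open>t a\<^sup>n\<close>, and \<open>a \<mapsto> c\<close>, \<open>t \<mapsto> 1\<close> counts the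
  occurrences of \<open>a\<close> up to two; together they separate the elements of \<open>M\<close> for \<open>t a\<^sup>+\<close>, and
  conversely the former assignment factors through that monoid. The other
  monoids are treated likewise, with \<open>E\<^sup>1\<close> and its dual embedded in \<open>B\<^sub>0\<^sup>1\<close>.
\<close>

section \<open>Varieties of monoids\<close>

text \<open>The generators live in types of their own, so membership in a variety is replaced by
  \<open>copies_in\<close>, and equality of two generated varieties by the statement that the same
  varieties contain copies of both generators. A join then becomes a conjunction, and no product of
  generators has to be formed. The congruence \<open>gamma\<close> has two ingredients, and each
  table has elements of two matching kinds. Idempotent values respect words up to repetition of
  adjacent letters; an element c with c q c = 0 for all q tells single letters from multiple ones.
  In E and its dual the second kind is the generator c; in A_0, which is presented by idempotents
  only, it is the product fe. The class of a^+ta^+ adds nothing to the join because its own words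
  leave nothing to be measured: all a^m t a^n with m and n positive are congruent, so it is enough
  to recognize them by the failure of the tests for ta^+ and a^+t on a word with a single t.\<close>

definition copies_in :: "'x::infinite monoid set \<Rightarrow> 'g monoid \<Rightarrow> bool" where
  "copies_in V G \<longleftrightarrow> (\<forall>N. monoid N \<and> N \<cong> G \<longrightarrow> N \<in> V)"

text \<open>Membership in \<open>epi\<close> means multiplicativity and surjectivity only. A
  preimage \<open>x\<close> of the identity of \<open>G\<close>, multiplied on the left by the
  identity of \<open>P\<close>, yields the missing condition.\<close>

lemma epi_one:
  assumes "monoid P" "monoid G" "f \<in> epi P G"
  shows "f \<one>\<^bsub>P\<^esub> = \<one>\<^bsub>G\<^esub>"
proof -
  interpret P: monoid P by fact
  interpret G: monoid G by fact
  have f: "f \<in> hom P G" and surj: "f ` carrier P = carrier G"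
    using assms(3) by (auto simp: epi_def)
  obtain x where x: "x \<in> carrier P" "f x = \<one>\<^bsub>G\<^esub>"
    using surj G.one_closed by (metis imageE)
  have "f \<one>\<^bsub>P\<^esub> = f \<one>\<^bsub>P\<^esub> \<otimes>\<^bsub>G\<^esub> f x"
    using x surj by (metis G.r_one P.one_closed imageI)
  also have "\<dots> = f (\<one>\<^bsub>P\<^esub> \<otimes>\<^bsub>P\<^esub> x)"
    using hom_mult[OF f P.one_closed x(1)] by simp
  finally show ?thesis using x by simp
qed

lemma iso_inverse:
  assumes "monoid G" "h \<in> iso G H"
  shows "inv_into (carrier G) h \<in> iso H G"
proof -
  interpret G: monoid G by fact
  have h: "h \<in> hom G H" "bij_betw h (carrier G) (carrier H)"
    using assms by (auto simp: iso_def)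
  then have bij: "bij_betw (inv_into (carrier G) h) (carrier H) (carrier G)"
    by (simp add: bij_betw_inv_into)
  have "inv_into (carrier G) h \<in> hom H G"
  proof (rule homI)
    fix x y assume xy: "x \<in> carrier H" "y \<in> carrier H"
    have *: "inv_into (carrier G) h x \<in> carrier G" "inv_into (carrier G) h y \<in> carrier G"
      using xy bij by (auto dest: bij_betwE)
    have "h (inv_into (carrier G) h x \<otimes>\<^bsub>G\<^esub> inv_into (carrier G) h y) = x \<otimes>\<^bsub>H\<^esub> y"
      using * h xy by (simp add: hom_def bij_betw_inv_into_right)
    with * show "inv_into (carrier G) h (x \<otimes>\<^bsub>H\<^esub> y)
        = inv_into (carrier G) h x \<otimes>\<^bsub>G\<^esub> inv_into (carrier G) h y"
      by (metis G.m_closed bij_betw_inv_into_left h(2))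
  qed (use bij in \<open>auto dest: bij_betwE\<close>)
  with bij show ?thesis by (simp add: isoI)
qed

lemma is_iso_sym: "monoid G \<Longrightarrow> G \<cong> H \<Longrightarrow> H \<cong> G"
  unfolding is_iso_def using iso_inverse by blast

lemma copies_in_iso:
  fixes U :: "'x::infinite monoid set"
  assumes "monoid G" "G \<cong> H"
  shows "copies_in U G \<longleftrightarrow> copies_in U H"
proof -
  have "N \<cong> G \<longleftrightarrow> N \<cong> H" for N :: "'x monoid"
    using iso_trans[of N G H] iso_trans[of N H G] assms is_iso_sym[OF assms] by blast
  then show ?thesis by (simp add: copies_in_def)
qed

lemma countable_copy:
  fixes H :: "'h monoid"
  assumes "monoid H" "countable (carrier H)"
  shows "\<exists>(N :: 'x::infinite monoid) \<kappa>. monoid N \<and> \<kappa> \<in> iso H N"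
proof -
  interpret H: monoid H by fact
  obtain \<nu> :: "nat \<Rightarrow> 'x" where "inj \<nu>"
    using infinite_UNIV infinite_countable_subset by blast
  then obtain \<kappa> :: "'h \<Rightarrow> 'x" where \<kappa>: "inj_on \<kappa> (carrier H)"
    using inj_on_to_nat_on[OF assms(2)] by (metis comp_inj_on inj_on_subset subset_UNIV)
  let ?g = "inv_into (carrier H) \<kappa>"
  let ?N = "\<lparr>carrier = \<kappa> ` carrier H, monoid.mult = (\<lambda>x y. \<kappa> (?g x \<otimes>\<^bsub>H\<^esub> ?g y)), one = \<kappa> \<one>\<^bsub>H\<^esub>\<rparr>"
  have "monoid ?N"
    by (rule monoidI) (auto simp: \<kappa> H.m_assoc)
  moreover have "\<kappa> \<in> iso H ?N"
    by (rule isoI) (auto simp: hom_def \<kappa> bij_betw_def)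
  ultimately show ?thesis by blast
qed

lemma monoid_variety_monoid: "monoid_variety V \<Longrightarrow> N \<in> V \<Longrightarrow> monoid N"
  unfolding monoid_variety_def by (drule conjunct1) (rule bspec)

lemma monoid_variety_closed:
  fixes V :: "'x::infinite monoid set" and I :: "'x set"
  assumes V: "monoid_variety V" and "\<And>i. i \<in> I \<Longrightarrow> M i \<in> V"
    and "submonoid S (product_group I M)" "monoid N"
    and "\<phi> \<in> epi ((product_group I M)\<lparr>carrier := S\<rparr>) N" "\<phi> \<one>\<^bsub>product_group I M\<^esub> = \<one>\<^bsub>N\<^esub>"
  shows "N \<in> V"
  using V[unfolded monoid_variety_def, THEN conjunct2, THEN spec, of I, THEN spec, of M,
      THEN spec, of S, THEN spec, of N, THEN spec, of \<phi>] assms(2-)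
  by simp

text \<open>The maps \<open>h i\<close> combine into \<open>\<Delta>\<close> from \<open>P\<close>
  onto a submonoid \<open>S\<close> of the product, and by \<open>sep\<close> the map
  \<open>\<phi>\<close> factors through \<open>S\<close>. Thus \<open>N\<close> appears in the shape
  that closure demands, whatever the type and size of \<open>P\<close>.\<close>

lemma member_if_separated:
  fixes V :: "'x::infinite monoid set" and P :: "'p monoid" and I :: "'x set"
  assumes V: "monoid_variety V" and "monoid P" and "monoid N"
    and M: "\<And>i. i \<in> I \<Longrightarrow> M i \<in> V"
    and h: "\<And>i. i \<in> I \<Longrightarrow> h i \<in> hom P (M i)" "\<And>i. i \<in> I \<Longrightarrow> h i \<one>\<^bsub>P\<^esub> = \<one>\<^bsub>M i\<^esub>"
    and \<phi>: "\<phi> \<in> epi P N"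
    and sep: "\<And>x y. \<lbrakk>x \<in> carrier P; y \<in> carrier P; \<And>i. i \<in> I \<Longrightarrow> h i x = h i y\<rbrakk> \<Longrightarrow> \<phi> x = \<phi> y"
  shows "N \<in> V"
proof -
  interpret P: monoid P by fact
  define \<Delta> where "\<Delta> x = (\<lambda>i\<in>I. h i x)" for x
  have \<Delta>_apply: "\<Delta> x i = h i x" if "i \<in> I" for x i
    using that by (simp add: \<Delta>_def)
  define S where "S = \<Delta> ` carrier P"
  define \<psi> where "\<psi> s = \<phi> (inv_into (carrier P) \<Delta> s)" for s
  \<comment> \<open>The preimage chosen by \<open>inv_into\<close> is immaterial: two preimages
    agree under every \<open>h i\<close>, so \<open>sep\<close> identifies their images.\<close>
  have \<psi>: "\<psi> (\<Delta> x) = \<phi> x" if "x \<in> carrier P" for x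
    unfolding \<psi>_def
  proof (rule sep)
    show "inv_into (carrier P) \<Delta> (\<Delta> x) \<in> carrier P"
      using that by (intro inv_into_into) auto
    have "\<Delta> (inv_into (carrier P) \<Delta> (\<Delta> x)) = \<Delta> x"
      using that by (intro f_inv_into_f) auto
    then show "h i (inv_into (carrier P) \<Delta> (\<Delta> x)) = h i x" if "i \<in> I" for i
      using fun_cong[of _ _ i] that \<Delta>_apply by metis
  qed fact
  have mult: "\<Delta> x \<otimes>\<^bsub>product_group I M\<^esub> \<Delta> y = \<Delta> (x \<otimes>\<^bsub>P\<^esub> y)" if "x \<in> carrier P" "y \<in> carrier P" for x y
    using that h(1) by (auto simp: \<Delta>_def hom_def intro!: restrict_ext)
  have one: "\<one>\<^bsub>product_group I M\<^esub> = \<Delta> \<one>\<^bsub>P\<^esub>"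
    using h(2) by (auto simp: \<Delta>_def intro!: restrict_ext)
  have sub: "submonoid S (product_group I M)"
  proof
    show "S \<subseteq> carrier (product_group I M)"
      using h(1) by (fastforce simp: S_def \<Delta>_def hom_def)
    show "\<one>\<^bsub>product_group I M\<^esub> \<in> S"
      unfolding one S_def by blast
    show "x \<otimes>\<^bsub>product_group I M\<^esub> y \<in> S" if "x \<in> S" "y \<in> S" for x y
      using that mult unfolding S_def by force
  qed
  have \<phi>': "\<phi> \<in> hom P N" "\<phi> ` carrier P = carrier N"
    using \<phi> by (auto simp: epi_def)
  have "\<psi> \<in> hom ((product_group I M)\<lparr>carrier := S\<rparr>) N"
  proof (rule homI)
    fix x assume "x \<in> carrier ((product_group I M)\<lparr>carrier := S\<rparr>)"
    then show "\<psi> x \<in> carrier N"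
      using \<psi> \<phi>'(2) by (auto simp: S_def)
  next
    fix x y assume "x \<in> carrier ((product_group I M)\<lparr>carrier := S\<rparr>)" "y \<in> carrier ((product_group I M)\<lparr>carrier := S\<rparr>)"
    then obtain p q where pq: "x = \<Delta> p" "y = \<Delta> q" "p \<in> carrier P" "q \<in> carrier P"
      by (auto simp: S_def)
    have "x \<otimes>\<^bsub>(product_group I M)\<lparr>carrier := S\<rparr>\<^esub> y = \<Delta> (p \<otimes>\<^bsub>P\<^esub> q)"
      using mult pq by simp
    then show "\<psi> (x \<otimes>\<^bsub>(product_group I M)\<lparr>carrier := S\<rparr>\<^esub> y) = \<psi> x \<otimes>\<^bsub>N\<^esub> \<psi> y"
      using \<psi> \<phi>'(1) pq by (simp add: hom_def)
  qed
  moreover have "\<psi> ` S = carrier N"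
    using \<psi> \<phi>'(2) unfolding S_def by (force simp: image_image)
  ultimately have "\<psi> \<in> epi ((product_group I M)\<lparr>carrier := S\<rparr>) N"
    by (simp add: epi_def)
  moreover have "\<psi> \<one>\<^bsub>product_group I M\<^esub> = \<one>\<^bsub>N\<^esub>"
    using epi_one[OF \<open>monoid P\<close> \<open>monoid N\<close> \<phi>] \<psi> one by simp
  ultimately show ?thesis
    using monoid_variety_closed[OF V M sub \<open>monoid N\<close>] by blast
qed

text \<open>A hypothesis \<open>copies_in U (H j)\<close> is vacuous when \<open>H j\<close> is too
  large to be copied into \<open>'x\<close>. Countable carriers guarantee actual copies, and
  countability of \<open>J\<close> lets its elements be renamed into the index type
  \<open>'x\<close>.\<close>

lemma copies_in_separated:
  fixes U :: "'x::infinite monoid set" and P :: "'p monoid" and G :: "'g monoid"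
    and H :: "'j \<Rightarrow> 'h monoid"
  assumes U: "monoid_variety U" and "monoid P" and "countable J"
    and H: "\<And>j. j \<in> J \<Longrightarrow> monoid (H j)" "\<And>j. j \<in> J \<Longrightarrow> countable (carrier (H j))"
      "\<And>j. j \<in> J \<Longrightarrow> copies_in U (H j)"
    and h: "\<And>j. j \<in> J \<Longrightarrow> h j \<in> hom P (H j)" "\<And>j. j \<in> J \<Longrightarrow> h j \<one>\<^bsub>P\<^esub> = \<one>\<^bsub>H j\<^esub>"
    and \<phi>: "\<phi> \<in> epi P G"
    and sep: "\<And>x y. \<lbrakk>x \<in> carrier P; y \<in> carrier P; \<And>j. j \<in> J \<Longrightarrow> h j x = h j y\<rbrakk> \<Longrightarrow> \<phi> x = \<phi> y"
  shows "copies_in U G"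
  unfolding copies_in_def
proof (intro allI impI)
  fix N :: "'x monoid"
  assume N: "monoid N \<and> N \<cong> G"
  then obtain \<sigma> where "\<sigma> \<in> iso N G" unfolding is_iso_def by blast
  then have \<rho>: "inv_into (carrier N) \<sigma> \<in> epi G N"
    using iso_inverse N iso_iff_mon_epi by blast
  have "\<forall>j. \<exists>(M :: 'x monoid) \<kappa>. j \<in> J \<longrightarrow> monoid M \<and> \<kappa> \<in> iso (H j) M"
    using countable_copy H by meson
  then obtain M :: "'j \<Rightarrow> 'x monoid" and \<kappa> where
    M: "\<And>j. j \<in> J \<Longrightarrow> monoid (M j)" "\<And>j. j \<in> J \<Longrightarrow> \<kappa> j \<in> iso (H j) (M j)"
    by metis
  obtain \<nu> :: "nat \<Rightarrow> 'x" where "inj \<nu>"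
    using infinite_UNIV infinite_countable_subset by blast
  then obtain \<iota> :: "'j \<Rightarrow> 'x" where \<iota>: "inj_on \<iota> J"
    using inj_on_to_nat_on[OF \<open>countable J\<close>] by (metis comp_inj_on inj_on_subset subset_UNIV)
  let ?r = "inv_into J \<iota>"
  show "N \<in> U"
  proof (rule member_if_separated[where I = "\<iota> ` J" and M = "\<lambda>i. M (?r i)"
        and h = "\<lambda>i. \<kappa> (?r i) \<circ> h (?r i)" and \<phi> = "inv_into (carrier N) \<sigma> \<circ> \<phi>"])
    show "inv_into (carrier N) \<sigma> \<circ> \<phi> \<in> epi P N"
      using \<phi> \<rho> by (rule epi_compose)
    fix i assume "i \<in> \<iota> ` J"
    then have r: "?r i \<in> J" by (rule inv_into_into)
    have "M (?r i) \<cong> H (?r i)"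
      using M(2)[OF r] H(1)[OF r] is_isoI is_iso_sym by blast
    then show "M (?r i) \<in> U"
      using H(3)[OF r] M(1)[OF r] unfolding copies_in_def by blast
    show "\<kappa> (?r i) \<circ> h (?r i) \<in> hom P (M (?r i))"
      using hom_compose[OF h(1)[OF r]] M(2)[OF r] iso_imp_homomorphism by blast
    show "(\<kappa> (?r i) \<circ> h (?r i)) \<one>\<^bsub>P\<^esub> = \<one>\<^bsub>M (?r i)\<^esub>"
      using h(2)[OF r] epi_one H(1)[OF r] M(1)[OF r] M(2)[OF r] iso_iff_mon_epi by fastforce
  next
    fix x y
    assume xy: "x \<in> carrier P" "y \<in> carrier P"
      and eq: "\<And>i. i \<in> \<iota> ` J \<Longrightarrow> (\<kappa> (?r i) \<circ> h (?r i)) x = (\<kappa> (?r i) \<circ> h (?r i)) y"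
    have "h j x = h j y" if "j \<in> J" for j
    proof -
      have "\<kappa> j (h j x) = \<kappa> j (h j y)"
        using eq[of "\<iota> j"] that \<iota> by simp
      moreover have "inj_on (\<kappa> j) (carrier (H j))"
        using M(2)[OF that] by (simp add: iso_iff)
      moreover have "h j x \<in> carrier (H j)" "h j y \<in> carrier (H j)"
        using h(1)[OF that] xy by (auto simp: hom_def)
      ultimately show ?thesis by (meson inj_onD)
    qed
    with xy have "\<phi> x = \<phi> y" by (rule sep)
    then show "(inv_into (carrier N) \<sigma> \<circ> \<phi>) x = (inv_into (carrier N) \<sigma> \<circ> \<phi>) y"
      by simp
  qed (use U N \<open>monoid P\<close> in auto)
qed

lemma copies_in_quotient:
  fixes P :: "'p monoid" and H :: "'h monoid" and G :: "'g monoid"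
  assumes "monoid_variety U" "monoid P" "monoid H" "countable (carrier H)" "copies_in U H"
    and "h \<in> hom P H" "h \<one>\<^bsub>P\<^esub> = \<one>\<^bsub>H\<^esub>" "\<phi> \<in> epi P G"
    and "\<And>x y. \<lbrakk>x \<in> carrier P; y \<in> carrier P; h x = h y\<rbrakk> \<Longrightarrow> \<phi> x = \<phi> y"
  shows "copies_in U G"
proof (rule copies_in_separated[where P = P and \<phi> = \<phi> and J = "{()}" and H = "\<lambda>_. H" and h = "\<lambda>_. h"])
  fix x y
  assume xy: "x \<in> carrier P" "y \<in> carrier P" and h: "\<And>j. j \<in> {()} \<Longrightarrow> h x = h y"
  show "\<phi> x = \<phi> y" by (rule assms(9)[OF xy h]) simp
qed (simp_all add: assms(1-8))

text \<open>Saves checking associativity in a Rees quotient: it is inherited from the free monoid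
  through \<open>M_class\<close>.\<close>

lemma monoid_epi_image:
  assumes "monoid P" and f: "f \<in> epi P G" and one: "f \<one>\<^bsub>P\<^esub> = \<one>\<^bsub>G\<^esub>"
  shows "monoid G"
proof -
  interpret P: monoid P by fact
  have hom: "f x \<otimes>\<^bsub>G\<^esub> f y = f (x \<otimes>\<^bsub>P\<^esub> y)" if "x \<in> carrier P" "y \<in> carrier P" for x y
    using f that by (auto simp: epi_def hom_def)
  have surj: "carrier G = f ` carrier P"
    using f by (auto simp: epi_def)
  show ?thesis
    by (rule monoidI) (auto simp: surj hom P.m_assoc simp flip: one)
qed

text \<open>Both images are the quotient of \<open>P\<close> by one kernel. This identifies a
  multiplication table with a presented semigroup.\<close>

lemma iso_if_same_kernel:
  assumes "monoid P" and f: "f \<in> epi P G" and g: "g \<in> epi P H"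
    and ker: "\<And>x y. \<lbrakk>x \<in> carrier P; y \<in> carrier P\<rbrakk> \<Longrightarrow> f x = f y \<longleftrightarrow> g x = g y"
  shows "G \<cong> H"
proof -
  interpret P: monoid P by fact
  let ?s = "inv_into (carrier P) f"
  have f': "f \<in> hom P G" "f ` carrier P = carrier G" and g': "g \<in> hom P H" "g ` carrier P = carrier H"
    using f g by (auto simp: epi_def)
  have s: "?s x \<in> carrier P" "f (?s x) = x" if "x \<in> carrier G" for x
    using that f'(2) inv_into_into f_inv_into_f by metis+
  have gs: "g (?s (f x)) = g x" if "x \<in> carrier P" for x
    using s[of "f x"] that ker f'(2) by blast
  have "g \<circ> ?s \<in> hom G H"
  proof (rule homI)
    fix x y assume xy: "x \<in> carrier G" "y \<in> carrier G"
    then have "x \<otimes>\<^bsub>G\<^esub> y = f (?s x \<otimes>\<^bsub>P\<^esub> ?s y)"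
      using s f'(1) by (simp add: hom_def)
    then show "(g \<circ> ?s) (x \<otimes>\<^bsub>G\<^esub> y) = (g \<circ> ?s) x \<otimes>\<^bsub>H\<^esub> (g \<circ> ?s) y"
      using gs s xy g'(1) by (simp add: hom_def)
  qed (use s g'(2) in auto)
  moreover have "inj_on (g \<circ> ?s) (carrier G)"
    using s ker by (auto intro!: inj_onI) metis
  moreover have "(g \<circ> ?s) ` carrier G = carrier H"
    unfolding f'(2)[symmetric] g'(2)[symmetric] image_comp
    using gs by (intro image_cong) auto
  ultimately have "g \<circ> ?s \<in> iso G H"
    unfolding iso_iff by blast
  then show ?thesis by (rule is_isoI)
qed

section \<open>Generated varieties and joins\<close>

lemma monoid_variety_Inter:
  assumes "\<And>V. V \<in> A \<Longrightarrow> monoid_variety V" and "A \<noteq> {}"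
  shows "monoid_variety (\<Inter>A)"
  unfolding monoid_variety_def
proof (intro conjI allI impI)
  obtain V where "V \<in> A" using \<open>A \<noteq> {}\<close> by blast
  then show "\<forall>N\<in>\<Inter>A. monoid N"
    using monoid_variety_monoid[OF assms(1)] by blast
  fix I :: "'a set" and M S and N :: "'a monoid" and \<phi>
  assume A: "(\<forall>i\<in>I. M i \<in> \<Inter>A) \<and> submonoid S (product_group I M) \<and> monoid N \<and>
    \<phi> \<in> epi ((product_group I M)\<lparr>carrier := S\<rparr>) N \<and> \<phi> \<one>\<^bsub>product_group I M\<^esub> = \<one>\<^bsub>N\<^esub>"
  show "N \<in> \<Inter>A"
  proof
    fix V assume "V \<in> A"
    show "N \<in> V"
      by (rule monoid_variety_closed[OF assms(1)[OF \<open>V \<in> A\<close>], of I M S _ \<phi>])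
        (use A \<open>V \<in> A\<close> in auto)
  qed
qed

text \<open>Keeps the family whose intersection is a generated variety nonempty.\<close>

lemma monoid_variety_monoids: "monoid_variety {N :: 'x::infinite monoid. monoid N}"
  by (simp add: monoid_variety_def)

lemma generated_variety_alt:
  "generated_variety G = \<Inter>{V :: 'x::infinite monoid set. monoid_variety V \<and> copies_in V G}"
  by (simp add: generated_variety_def copies_in_def)

lemma monoid_variety_generated: "monoid_variety (generated_variety G :: 'x::infinite monoid set)"
  unfolding generated_variety_alt
  by (rule monoid_variety_Inter) (use monoid_variety_monoids in \<open>auto simp: copies_in_def\<close>)

lemma generated_variety_subset_iff:
  fixes U :: "'x::infinite monoid set"
  assumes "monoid_variety U"
  shows "generated_variety G \<subseteq> U \<longleftrightarrow> copies_in U G"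
proof
  assume "generated_variety G \<subseteq> U"
  moreover have "copies_in (generated_variety G :: 'x monoid set) G"
    by (simp add: generated_variety_alt copies_in_def)
  ultimately show "copies_in U G"
    by (auto simp: copies_in_def)
next
  assume "copies_in U G"
  with assms show "generated_variety G \<subseteq> U"
    unfolding generated_variety_alt by (intro Inter_lower) simp
qed

text \<open>A generated variety is the intersection of the varieties containing copies of its
  generator, so comparing these families suffices and no member is examined. Every equality of the
  theorem except that of the join is obtained this way.\<close>

lemma generated_variety_cong:
  assumes "\<And>U :: 'x::infinite monoid set. monoid_variety U \<Longrightarrow> copies_in U G \<longleftrightarrow> copies_in U H"
  shows "(generated_variety G :: 'x monoid set) = generated_variety H"
  using assms unfolding generated_variety_alt by (intro arg_cong[where f = Inter] Collect_cong) auto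

text \<open>The conjunction stands in for the direct product of \<open>G\<close> and
  \<open>H\<close>.\<close>

lemma variety_join_generated:
  assumes "\<And>U :: 'x::infinite monoid set. monoid_variety U \<Longrightarrow>
      copies_in U G \<and> copies_in U H \<longleftrightarrow> copies_in U K"
  shows "variety_join (generated_variety G) (generated_variety H)
      = (generated_variety K :: 'x monoid set)"
proof -
  have "monoid_variety U \<and> generated_variety G \<union> generated_variety H \<subseteq> U
      \<longleftrightarrow> monoid_variety U \<and> copies_in U K" for U :: "'x monoid set"
    using assms generated_variety_subset_iff by (metis Un_subset_iff)
  then show ?thesis
    by (simp add: variety_join_def generated_variety_alt)
qed

section \<open>Opposite monoids and dual varieties\<close>

lemma opposite_monoid_simps [simp]:
  "carrier (opposite_monoid G) = carrier G"
  "x \<otimes>\<^bsub>opposite_monoid G\<^esub> y = y \<otimes>\<^bsub>G\<^esub> x"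
  "\<one>\<^bsub>opposite_monoid G\<^esub> = \<one>\<^bsub>G\<^esub>"
  by (simp_all add: opposite_monoid_def)

lemma opposite_opposite [simp]: "opposite_monoid (opposite_monoid G) = (G :: 'g monoid)"
  by (simp add: opposite_monoid_def)

lemma monoid_opposite: "monoid G \<Longrightarrow> monoid (opposite_monoid G)"
  by (rule monoidI) (auto simp: monoid.m_assoc monoid.m_closed monoid.one_closed monoid.l_one monoid.r_one)

lemma monoid_opposite_iff [simp]: "monoid (opposite_monoid G) \<longleftrightarrow> monoid (G :: 'g monoid)"
  using monoid_opposite opposite_opposite by metis

lemma iso_opposite: "\<phi> \<in> iso G H \<Longrightarrow> \<phi> \<in> iso (opposite_monoid G) (opposite_monoid H)"
  by (auto simp: iso_def hom_def)

lemma is_iso_opposite: "G \<cong> H \<Longrightarrow> opposite_monoid G \<cong> opposite_monoid H"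
  unfolding is_iso_def using iso_opposite by blast

lemma monoid_variety_iso_closed:
  assumes V: "monoid_variety V" and "M \<in> V" "monoid N" "N \<cong> M"
  shows "N \<in> V"
proof -
  have M: "monoid M"
    using V \<open>M \<in> V\<close> by (rule monoid_variety_monoid)
  then obtain \<phi> where "\<phi> \<in> iso M N"
    using is_iso_sym assms(3,4) unfolding is_iso_def by blast
  then have "\<phi> \<in> epi M N" by (simp add: iso_iff_mon_epi)
  \<comment> \<open>A constant family with identity maps: \<open>M\<close> is separated by itself,
    and \<open>N\<close> is its image.\<close>
  then show ?thesis
    by (rule member_if_separated[OF V M \<open>monoid N\<close>, of UNIV "\<lambda>_. M" "\<lambda>_ x. x", rotated 3])
      (simp_all add: \<open>M \<in> V\<close> hom_def)
qed

text \<open>Closure under isomorphism absorbs the isomorphism in the definition of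
  \<open>dual_variety\<close>.\<close>

lemma mem_dual_variety_iff:
  assumes "monoid_variety V"
  shows "N \<in> dual_variety V \<longleftrightarrow> opposite_monoid N \<in> V"
proof
  assume "N \<in> dual_variety V"
  then obtain M where "monoid N" "M \<in> V" "N \<cong> opposite_monoid M"
    by (auto simp: dual_variety_def)
  then show "opposite_monoid N \<in> V"
    using monoid_variety_iso_closed[OF assms] is_iso_opposite[of N "opposite_monoid M"] by simp
next
  assume N: "opposite_monoid N \<in> V"
  then have "monoid N"
    using monoid_variety_monoid[OF assms N] by simp
  with N show "N \<in> dual_variety V"
    unfolding dual_variety_def by (metis (mono_tags, lifting) iso_refl mem_Collect_eq opposite_opposite)
qed

text \<open>Taking opposites commutes with products, submonoids and homomorphic images; the set
  \<open>S\<close> and the map \<open>\<phi>\<close> stay the same.\<close>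

lemma monoid_variety_dual:
  fixes V :: "'x::infinite monoid set"
  assumes V: "monoid_variety V"
  shows "monoid_variety (dual_variety V)"
  unfolding monoid_variety_def
proof (intro conjI allI impI)
  show "\<forall>N\<in>dual_variety V. monoid N"
    by (simp add: dual_variety_def)
  fix I :: "'x set" and M S \<phi> and N :: "'x monoid"
  assume A: "(\<forall>i\<in>I. M i \<in> dual_variety V) \<and> submonoid S (product_group I M) \<and> monoid N \<and>
    \<phi> \<in> epi ((product_group I M)\<lparr>carrier := S\<rparr>) N \<and> \<phi> \<one>\<^bsub>product_group I M\<^esub> = \<one>\<^bsub>N\<^esub>"
  let ?M = "\<lambda>i. opposite_monoid (M i)"
  have "\<forall>i\<in>I. ?M i \<in> V"
    using A mem_dual_variety_iff[OF V] by blast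
  moreover have "submonoid S (product_group I ?M)"
    using A by (auto simp: submonoid_def)
  moreover have "\<phi> \<in> epi ((product_group I ?M)\<lparr>carrier := S\<rparr>) (opposite_monoid N)"
    using A by (auto simp: epi_def hom_def)
  moreover have "\<phi> \<one>\<^bsub>product_group I ?M\<^esub> = \<one>\<^bsub>opposite_monoid N\<^esub>"
    using A by simp
  moreover have "monoid (opposite_monoid N)"
    using A by simp
  ultimately have "opposite_monoid N \<in> V"
    using monoid_variety_closed[OF V, of I ?M S "opposite_monoid N" \<phi>] by blast
  then show "N \<in> dual_variety V"
    by (simp add: mem_dual_variety_iff[OF V])
qed

lemma copies_in_dual:
  fixes V :: "'x::infinite monoid set"
  assumes "monoid_variety V"
  shows "copies_in (dual_variety V) G \<longleftrightarrow> copies_in V (opposite_monoid G)"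
proof -
  have iso: "opposite_monoid N \<cong> opposite_monoid G \<longleftrightarrow> N \<cong> G" for N :: "'x monoid"
    using is_iso_opposite[of N G] is_iso_opposite[of "opposite_monoid N" "opposite_monoid G"] by auto
  \<comment> \<open>Taking opposites is an involution, so the quantified monoid may be replaced by
    its opposite.\<close>
  have all: "(\<forall>N :: 'x monoid. Q N) \<longleftrightarrow> (\<forall>N. Q (opposite_monoid N))" for Q
    using opposite_opposite by metis
  have "copies_in V (opposite_monoid G) \<longleftrightarrow>
      (\<forall>N :: 'x monoid. monoid (opposite_monoid N) \<and> opposite_monoid N \<cong> opposite_monoid G
        \<longrightarrow> opposite_monoid N \<in> V)"
    unfolding copies_in_def by (rule all)
  then show ?thesis
    by (simp add: iso copies_in_def mem_dual_variety_iff[OF assms])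
qed

lemma dual_generated_variety:
  "dual_variety (generated_variety G) = (generated_variety (opposite_monoid G) :: 'x::infinite monoid set)"
proof
  let ?V = "generated_variety G :: 'x monoid set"
  have V: "monoid_variety ?V" by (rule monoid_variety_generated)
  show "generated_variety (opposite_monoid G) \<subseteq> dual_variety ?V"
    using generated_variety_subset_iff[OF V, of G]
    by (simp add: generated_variety_subset_iff monoid_variety_dual V copies_in_dual)
  let ?W = "generated_variety (opposite_monoid G) :: 'x monoid set"
  have W: "monoid_variety ?W" by (rule monoid_variety_generated)
  \<comment> \<open>This is the first inclusion for the opposite generator; dualizing it gives the
    remaining one.\<close>
  have "?V \<subseteq> dual_variety ?W"
    using generated_variety_subset_iff[OF W, of "opposite_monoid G"]
    by (simp add: generated_variety_subset_iff monoid_variety_dual W copies_in_dual)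
  then show "dual_variety ?V \<subseteq> ?W"
    using mem_dual_variety_iff[OF V] mem_dual_variety_iff[OF W] by fastforce
qed

section \<open>Words modulo a congruence\<close>

definition word_monoid :: "'l list monoid" where
  "word_monoid = \<lparr>carrier = UNIV, monoid.mult = (@), one = []\<rparr>"

lemma word_monoid_simps [simp]:
  "carrier word_monoid = UNIV" "x \<otimes>\<^bsub>word_monoid\<^esub> y = x @ y" "\<one>\<^bsub>word_monoid\<^esub> = []"
  by (simp_all add: word_monoid_def)

lemma monoid_word_monoid: "monoid word_monoid"
  by (rule monoidI) auto

definition word_congruence :: "('l list \<times> 'l list) set \<Rightarrow> bool" where
  "word_congruence \<tau> \<longleftrightarrow> equiv UNIV \<tau> \<and> (\<forall>u v p s. (u, v) \<in> \<tau> \<longrightarrow> (p @ u @ s, p @ v @ s) \<in> \<tau>)"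

lemma word_congruence_equiv: "word_congruence \<tau> \<Longrightarrow> equiv UNIV \<tau>"
  by (simp add: word_congruence_def)

lemma word_congruence_context:
  "word_congruence \<tau> \<Longrightarrow> (u, v) \<in> \<tau> \<Longrightarrow> (p @ u @ s, p @ v @ s) \<in> \<tau>"
  by (simp add: word_congruence_def)

lemma word_congruence_refl: "word_congruence \<tau> \<Longrightarrow> (u, u) \<in> \<tau>"
  using word_congruence_equiv equiv_class_eq_iff by fastforce

lemma word_congruence_sym: "word_congruence \<tau> \<Longrightarrow> (u, v) \<in> \<tau> \<Longrightarrow> (v, u) \<in> \<tau>"
  using word_congruence_equiv by (meson equivE symE)

lemma word_congruence_trans:
  "word_congruence \<tau> \<Longrightarrow> (u, v) \<in> \<tau> \<Longrightarrow> (v, w) \<in> \<tau> \<Longrightarrow> (u, w) \<in> \<tau>"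
  using word_congruence_equiv by (meson equivE transE)

lemma word_congruence_append:
  assumes "word_congruence \<tau>" "(u, u') \<in> \<tau>" "(v, v') \<in> \<tau>"
  shows "(u @ v, u' @ v') \<in> \<tau>"
  using word_congruence_context[OF assms(1,2), of "[]" v] word_congruence_context[OF assms(1,3), of u' "[]"]
    word_congruence_trans[OF assms(1)] by auto

lemma word_congruence_class_eq_iff:
  "word_congruence \<tau> \<Longrightarrow> \<tau> `` {u} = \<tau> `` {v} \<longleftrightarrow> (u, v) \<in> \<tau>"
  using eq_equiv_class_iff[OF word_congruence_equiv] by blast

text \<open>The union over all representatives collapses to one class because concatenation respects
  \<open>\<tau>\<close>.\<close>

lemma class_mult_class:
  assumes "word_congruence \<tau>"
  shows "class_mult \<tau> (\<tau> `` {u}) (\<tau> `` {v}) = \<tau> `` {u @ v}"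
proof -
  have "\<tau> `` {u' @ v'} = \<tau> `` {u @ v}" if "(u, u') \<in> \<tau>" "(v, v') \<in> \<tau>" for u' v'
    using word_congruence_append[OF assms] word_congruence_class_eq_iff[OF assms]
      word_congruence_sym[OF assms] that by blast
  moreover have "u \<in> \<tau> `` {u}" "v \<in> \<tau> `` {v}"
    using word_congruence_refl[OF assms] by auto
  ultimately show ?thesis
    unfolding class_mult_def by blast
qed

section \<open>The congruences \<open>tau1\<close> and \<open>gamma\<close>\<close>

lemma generated_congruence_context:
  "(u, v) \<in> generated_congruence R \<Longrightarrow> (p @ u @ s, p @ v @ s) \<in> generated_congruence R"
proof (induction rule: generated_congruence.induct)
  case (base u v p' s')
  then show ?case
    using generated_congruence.base[of u v R "p @ p'" "s' @ s"] by simp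
qed (blast intro: generated_congruence.intros)+

lemma word_congruence_generated: "word_congruence (generated_congruence R)"
  unfolding word_congruence_def equiv_def
  by (auto intro!: refl_onI symI transI generated_congruence_context
      intro: generated_congruence.refl generated_congruence.sym generated_congruence.trans)

lemma remdups_adj_duplicate: "remdups_adj (p @ x # x # s) = remdups_adj (p @ x # s)"
  by (simp add: remdups_adj_append[of p x "x # s"] remdups_adj_append[of p x s])

text \<open>\<open>remdups_adj\<close> is a normal form: the generating relations preserve it, and
  every word is related to its own normal form.\<close>

lemma tau1_iff_remdups_adj: "(u, v) \<in> tau1 \<longleftrightarrow> remdups_adj u = remdups_adj v"
proof
  assume "(u, v) \<in> tau1"
  then show "remdups_adj u = remdups_adj v"
    unfolding tau1_def
    by (induction rule: generated_congruence.induct) (auto simp: remdups_adj_duplicate)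
next
  have tau1: "word_congruence (tau1 :: ('a list \<times> 'a list) set)"
    unfolding tau1_def by (rule word_congruence_generated)
  have *: "(w, remdups_adj w) \<in> tau1" for w :: "'a list"
  proof (induction w rule: remdups_adj.induct)
    case (3 x y xs)
    show ?case
    proof (cases "x = y")
      case True
      have "([x], [x, x]) \<in> tau1"
        unfolding tau1_def using generated_congruence.base[of "[x]" "[x, x]" _ "[]" "[]"] by auto
      then have "(x # xs, x # x # xs) \<in> tau1"
        using word_congruence_context[OF tau1, of "[x]" "[x, x]" "[]" xs] by simp
      then show ?thesis
        using word_congruence_trans[OF tau1 word_congruence_sym[OF tau1] 3(1)[OF True]] True by simp
    next
      case False
      then show ?thesis
        using 3 word_congruence_context[OF tau1, of "y # xs" _ "[x]" "[]"] by simp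
    qed
  qed (use word_congruence_refl[OF tau1] in auto)
  assume "remdups_adj u = remdups_adj v"
  then show "(u, v) \<in> tau1"
    using *[of u] *[of v] word_congruence_trans[OF tau1] word_congruence_sym[OF tau1] by metis
qed

text \<open>Capped counts are preferred to \<open>multiple_letters\<close> because the capped count
  of a concatenation depends only on those of its parts. Words with equal \<open>remdups_adj\<close>
  have the same letters, so only the threshold 2 remains to be compared.\<close>

lemma gamma_iff:
  "(u, v) \<in> gamma \<longleftrightarrow>
    remdups_adj u = remdups_adj v \<and> (\<forall>x. min 2 (count_list u x) = min 2 (count_list v x))"
proof -
  have "multiple_letters u = multiple_letters v \<longleftrightarrow> (\<forall>x. min 2 (count_list u x) = min 2 (count_list v x))"
    if "remdups_adj u = remdups_adj v"
  proof -
    have "set u = set v" using that remdups_adj_set by metis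
    then have "count_list u x = 0 \<longleftrightarrow> count_list v x = 0" for x
      by (simp add: count_list_0_iff)
    moreover have "(2 \<le> m \<longleftrightarrow> 2 \<le> n) \<longleftrightarrow> min 2 m = min 2 n" if "m = 0 \<longleftrightarrow> n = 0" for m n :: nat
      using that by (auto simp: min_def)
    ultimately show ?thesis
      unfolding multiple_letters_def set_eq_iff mem_Collect_eq by metis
  qed
  then show ?thesis
    by (auto simp: gamma_def tau1_iff_remdups_adj)
qed

lemma word_congruence_gamma: "word_congruence gamma"
proof -
  have tau1: "word_congruence (tau1 :: ('a list \<times> 'a list) set)"
    unfolding tau1_def by (rule word_congruence_generated)
  have min: "min 2 (l + (m + n)) = min 2 (l + (m' + n))" if "min 2 m = min 2 m'" for l m m' n :: nat
    using that by (auto simp: min_def split: if_splits)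
  have "(p @ u @ s, p @ v @ s) \<in> gamma" if "(u, v) \<in> gamma" for u v p s :: "'a list"
    unfolding gamma_iff
  proof
    have uv: "(u, v) \<in> tau1" using that by (simp add: gamma_def)
    show "remdups_adj (p @ u @ s) = remdups_adj (p @ v @ s)"
      using word_congruence_context[OF tau1 uv, of p s] by (simp only: tau1_iff_remdups_adj)
    have *: "min 2 (count_list u x) = min 2 (count_list v x)" for x
      using that by (simp add: gamma_iff)
    show "\<forall>x. min 2 (count_list (p @ u @ s) x) = min 2 (count_list (p @ v @ s) x)"
      unfolding count_list_append by (intro allI min *)
  qed
  moreover have "equiv UNIV (gamma :: ('a list \<times> 'a list) set)"
    by (rule equivI) (auto simp: gamma_iff refl_on_def sym_def trans_def)
  ultimately show ?thesis
    by (simp add: word_congruence_def)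
qed

section \<open>Rees quotients as images of the free monoid\<close>

definition factor_word :: "('l list \<times> 'l list) set \<Rightarrow> 'l list set \<Rightarrow> 'l list \<Rightarrow> bool" where
  "factor_word \<tau> W u \<longleftrightarrow> (\<exists>w\<in>W. \<exists>p s. (p @ u @ s, w) \<in> \<tau>)"

definition word_classes :: "('l list \<times> 'l list) set \<Rightarrow> 'l list set \<Rightarrow> 'l list set set" where
  "word_classes \<tau> W = (\<lambda>w. \<tau> `` {w}) ` W"

text \<open>The canonical map of the free monoid onto the Rees quotient.\<close>

definition M_class :: "('l list \<times> 'l list) set \<Rightarrow> 'l list set \<Rightarrow> 'l list \<Rightarrow> 'l list set option" where
  "M_class \<tau> W u = (if factor_word \<tau> W u then Some (\<tau> `` {u}) else None)"

lemma factor_closure_class_iff: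
  assumes "word_congruence \<tau>"
  shows "\<tau> `` {u} \<in> factor_closure \<tau> (word_classes \<tau> W) \<longleftrightarrow> factor_word \<tau> W u"
proof -
  have "\<tau> `` {u} \<in> factor_closure \<tau> (word_classes \<tau> W) \<longleftrightarrow>
      (\<exists>w\<in>W. \<exists>p s. \<tau> `` {w} = class_mult \<tau> (class_mult \<tau> (\<tau> `` {p}) (\<tau> `` {u})) (\<tau> `` {s}))"
    by (auto simp: factor_closure_def word_classes_def quotient_def)
  also have "\<dots> \<longleftrightarrow> (\<exists>w\<in>W. \<exists>p s. (w, p @ u @ s) \<in> \<tau>)"
    by (simp add: class_mult_class[OF assms] word_congruence_class_eq_iff[OF assms])
  also have "\<dots> \<longleftrightarrow> factor_word \<tau> W u"
    unfolding factor_word_def using word_congruence_sym[OF assms] by blast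
  finally show ?thesis .
qed

lemma factor_wordD:
  assumes "factor_word \<tau> W (u @ v)"
  shows "factor_word \<tau> W u" "factor_word \<tau> W v"
proof -
  obtain w p s where w: "w \<in> W" "(p @ (u @ v) @ s, w) \<in> \<tau>"
    using assms by (auto simp: factor_word_def)
  have "(p @ u @ (v @ s), w) \<in> \<tau>" "((p @ u) @ v @ s, w) \<in> \<tau>"
    using w(2) by simp_all
  then show "factor_word \<tau> W u" "factor_word \<tau> W v"
    using w(1) unfolding factor_word_def by blast+
qed

text \<open>The word \<open>z\<close> is there for surjectivity: \<open>None\<close> always belongs
  to the carrier, but it is a value only if some word is not a factor. Multiplicativity rests on
  parts of factors being factors.\<close>

lemma M_class_epi:
  assumes \<tau>: "word_congruence \<tau>" and "\<not> factor_word \<tau> W z"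
  shows "M_class \<tau> W \<in> epi word_monoid (M_monoid \<tau> (word_classes \<tau> W))"
proof -
  let ?D = "factor_closure \<tau> (word_classes \<tau> W)"
  have D: "?D = (\<lambda>u. \<tau> `` {u}) ` {u. factor_word \<tau> W u}"
  proof -
    have "?D \<subseteq> range (\<lambda>u. \<tau> `` {u})"
      by (auto simp: factor_closure_def quotient_def)
    then show ?thesis
      using factor_closure_class_iff[OF \<tau>] by blast
  qed
  have carr: "carrier (M_monoid \<tau> (word_classes \<tau> W)) = insert None (Some ` ?D)"
    by (simp add: M_monoid_def Let_def)
  have "M_class \<tau> W \<in> hom word_monoid (M_monoid \<tau> (word_classes \<tau> W))"
  proof (rule homI)
    show "M_class \<tau> W u \<in> carrier (M_monoid \<tau> (word_classes \<tau> W))" for u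
      by (auto simp: carr M_class_def factor_closure_class_iff[OF \<tau>])
    show "M_class \<tau> W (u \<otimes>\<^bsub>word_monoid\<^esub> v)
        = M_class \<tau> W u \<otimes>\<^bsub>M_monoid \<tau> (word_classes \<tau> W)\<^esub> M_class \<tau> W v" for u v
      using factor_wordD[of \<tau> W u v]
      by (auto simp: M_class_def M_monoid_def Let_def class_mult_class[OF \<tau>] factor_closure_class_iff[OF \<tau>])
  qed
  moreover have "range (M_class \<tau> W) = carrier (M_monoid \<tau> (word_classes \<tau> W))"
  proof -
    have "M_class \<tau> W z = None"
      using assms(2) by (simp add: M_class_def)
    then show ?thesis
      unfolding carr D M_class_def by (auto simp: image_iff)
  qed
  ultimately show ?thesis
    by (simp add: epi_def)
qed

lemma M_class_Nil: "word_congruence \<tau> \<Longrightarrow> M_class \<tau> W [] = \<one>\<^bsub>M_monoid \<tau> (word_classes \<tau> W)\<^esub>"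
  by (simp add: M_class_def M_monoid_def Let_def factor_closure_class_iff)

lemma M_class_eq_iff:
  assumes "word_congruence \<tau>"
  shows "M_class \<tau> W u = M_class \<tau> W v \<longleftrightarrow>
    \<not> factor_word \<tau> W u \<and> \<not> factor_word \<tau> W v \<or> factor_word \<tau> W u \<and> factor_word \<tau> W v \<and> (u, v) \<in> \<tau>"
  by (auto simp: M_class_def word_congruence_class_eq_iff[OF assms])

section \<open>Values of words under assignments of letters\<close>

definition eval :: "('l \<Rightarrow> 'b::monoid_mult) \<Rightarrow> 'l list \<Rightarrow> 'b" where
  "eval f u = prod_list (map f u)"

lemma eval_simps [simp]:
  "eval f [] = 1" "eval f (x # u) = f x * eval f u" "eval f (u @ v) = eval f u * eval f v"
  "eval f (replicate n x) = f x ^ n"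
  by (simp_all add: eval_def)

text \<open>The carrier is a parameter so that several submonoids can share the multiplication of
  one type.\<close>

definition table_monoid :: "'b::monoid_mult set \<Rightarrow> 'b monoid" where
  "table_monoid S = \<lparr>carrier = S, monoid.mult = (*), one = 1\<rparr>"

lemma table_monoid_simps [simp]:
  "carrier (table_monoid S) = S" "x \<otimes>\<^bsub>table_monoid S\<^esub> y = x * y" "\<one>\<^bsub>table_monoid S\<^esub> = 1"
  by (simp_all add: table_monoid_def)

lemma monoid_table_monoid:
  "1 \<in> S \<Longrightarrow> (\<And>x y. x \<in> S \<Longrightarrow> y \<in> S \<Longrightarrow> x * y \<in> S) \<Longrightarrow> monoid (table_monoid S)"
  by (rule monoidI) (auto simp: mult.assoc)

lemma eval_hom:
  assumes "monoid (table_monoid S)" "range f \<subseteq> S"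
  shows "eval f \<in> hom word_monoid (table_monoid S)"
proof -
  interpret monoid "table_monoid S" by fact
  have "eval f u \<in> S" for u
    by (induction u) (use assms(2) m_closed one_closed in auto)
  then show ?thesis by (auto simp: hom_def)
qed

text \<open>Each assignment brings its own submonoid \<open>S\<close>, since some assignments take
  values in the copy of E^1 and others in that of its dual.\<close>

lemma copies_in_eval_separated:
  fixes U :: "'x::infinite monoid set" and F :: "('l \<Rightarrow> 'b::monoid_mult) set"
  assumes U: "monoid_variety U" and F: "countable F"
      "\<And>f. f \<in> F \<Longrightarrow> \<exists>S. range f \<subseteq> S \<and> monoid (table_monoid S) \<and> countable S \<and> copies_in U (table_monoid S)"
    and \<phi>: "\<phi> \<in> epi word_monoid G"
    and sep: "\<And>u v. (\<And>f. f \<in> F \<Longrightarrow> eval f u = eval f v) \<Longrightarrow> \<phi> u = \<phi> v"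
  shows "copies_in U G"
proof -
  obtain S where S: "\<And>f. f \<in> F \<Longrightarrow> range f \<subseteq> S f" "\<And>f. f \<in> F \<Longrightarrow> monoid (table_monoid (S f))"
    "\<And>f. f \<in> F \<Longrightarrow> countable (S f)" "\<And>f. f \<in> F \<Longrightarrow> copies_in U (table_monoid (S f))"
    using F(2) by metis
  show ?thesis
  proof (rule copies_in_separated[where P = word_monoid and J = F and H = "\<lambda>f. table_monoid (S f)"
        and h = eval and \<phi> = \<phi>])
    show "eval f \<in> hom word_monoid (table_monoid (S f))" if "f \<in> F" for f
      by (rule eval_hom) (use S that in blast)+
    show "\<phi> u = \<phi> v" if "\<And>f. f \<in> F \<Longrightarrow> eval f u = eval f v" for u v
      by (rule sep) (rule that)
  qed (simp_all add: U F(1) S \<phi> monoid_word_monoid)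
qed

text \<open>A letter that gets collapsed occurs at least twice, so idempotence is demanded of the
  values of multiple letters only.\<close>

lemma eval_remdups_adj:
  "(\<And>x. 2 \<le> count_list u x \<Longrightarrow> f x * f x = f x) \<Longrightarrow> eval f (remdups_adj u) = eval f u"
proof (induction u rule: remdups_adj.induct)
  case (3 x y xs)
  show ?case
  proof (cases "x = y")
    case True
    have "eval f (remdups_adj (x # xs)) = eval f (x # xs)"
      by (rule 3(1)[OF True]) (rule 3(3), simp add: True split: if_splits)
    moreover have "f x * f x = f x"
      by (rule 3(3)) (simp add: True)
    ultimately show ?thesis
      using True by (simp flip: mult.assoc)
  next
    case False
    have "eval f (remdups_adj (y # xs)) = eval f (y # xs)"
      by (rule 3(2)[OF False]) (rule 3(3), simp split: if_splits)
    then show ?thesis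
      using False by simp
  qed
qed auto

lemma count_list_ge_2_split:
  assumes "2 \<le> count_list u x"
  obtains p q s where "u = p @ x # q @ x # s"
proof -
  have "x \<in> set u"
    using assms count_list_0_iff[of u x] by fastforce
  then obtain p r where u: "u = p @ x # r" "x \<notin> set p"
    by (meson split_list_first)
  then have "x \<in> set r"
    using assms count_list_0_iff[of r x] by fastforce
  then obtain q s where "r = q @ x # s"
    by (meson split_list)
  with u that show ?thesis by simp
qed

text \<open>The evaluation respects \<open>gamma\<close> although a letter with non-idempotent value may occur once:
  a second occurrence of such a letter annihilates the word.\<close>

lemma eval_gamma:
  fixes f :: "'l \<Rightarrow> 'b::{monoid_mult, mult_zero}"
  assumes f: "\<And>x. f x * f x = f x \<or> (\<forall>q. f x * q * f x = 0)" and "(u, v) \<in> gamma"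
  shows "eval f u = eval f v"
proof (cases "\<exists>x. 2 \<le> count_list u x \<and> f x * f x \<noteq> f x")
  case True
  then obtain x where x: "2 \<le> count_list u x" "f x * f x \<noteq> f x" by blast
  have *: "eval f w = 0" if multiple: "2 \<le> count_list w x" for w
  proof -
    obtain p q s where w: "w = p @ x # q @ x # s"
      by (rule count_list_ge_2_split[OF multiple])
    have "eval f w = eval f p * (f x * eval f q * f x) * eval f s"
      by (simp add: w mult.assoc)
    also have "\<dots> = 0"
      using f[of x] x(2) by simp
    finally show ?thesis .
  qed
  have "min 2 (count_list u x) = min 2 (count_list v x)"
    using assms(2) by (simp add: gamma_iff)
  then have "2 \<le> count_list v x" using x(1) by simp
  then show ?thesis using * x(1) by simp
next
  case False
  have "2 \<le> count_list v x \<longleftrightarrow> 2 \<le> count_list u x" for x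
    using assms(2) unfolding gamma_iff by (metis min.absorb_iff1)
  then show ?thesis
    using False assms(2) eval_remdups_adj[of u f] eval_remdups_adj[of v f] by (simp add: gamma_iff)
qed

text \<open>Zero absorbs, so a nonzero value of \<open>w\<close> passes to everything that divides
  \<open>w\<close> modulo \<open>gamma\<close>. This is one half of each description of factors
  below.\<close>

lemma eval_factor_nonzero:
  fixes f :: "'l \<Rightarrow> 'b::{monoid_mult, mult_zero}"
  assumes f: "\<And>x. f x * f x = f x \<or> (\<forall>q. f x * q * f x = 0)"
    and "(p @ u @ s, w) \<in> gamma" and "eval f w \<noteq> 0"
  shows "eval f u \<noteq> 0"
proof
  assume "eval f u = 0"
  then have "eval f (p @ u @ s) = 0" by simp
  then show False
    using eval_gamma[OF f assms(2)] assms(3) by simp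
qed

lemma eval_epi:
  assumes "monoid (table_monoid S)" "range f \<subseteq> S" "S \<subseteq> range (eval f)"
  shows "eval f \<in> epi word_monoid (table_monoid S)"
  using eval_hom[OF assms(1,2)] assms(3) by (auto simp: epi_def hom_def)

text \<open>The evaluation factors through the Rees quotient: words with the same class have the
  same value by \<open>eval_gamma\<close>, and by \<open>zero\<close> the words collapsed to
  \<open>None\<close> all have value 0.\<close>

lemma copies_in_table_if_M:
  fixes U :: "'x::infinite monoid set" and W :: "'l::countable list set"
    and f :: "'l \<Rightarrow> 'b::{monoid_mult, mult_zero}"
  assumes "monoid_variety U" and M: "copies_in U (M_monoid gamma (word_classes gamma W))"
    and z: "\<not> factor_word gamma W z"
    and f: "\<And>x. f x * f x = f x \<or> (\<forall>q. f x * q * f x = 0)"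
    and S: "monoid (table_monoid S)" "range f \<subseteq> S" "S \<subseteq> range (eval f)"
    and zero: "\<And>u. eval f u \<noteq> 0 \<Longrightarrow> factor_word gamma W u"
  shows "copies_in U (table_monoid S)"
proof -
  let ?M = "M_monoid gamma (word_classes gamma W)"
  have epi: "M_class gamma W \<in> epi word_monoid ?M"
    by (rule M_class_epi[OF word_congruence_gamma z])
  have one: "M_class gamma W [] = \<one>\<^bsub>?M\<^esub>"
    by (rule M_class_Nil[OF word_congruence_gamma])
  show ?thesis
  proof (rule copies_in_quotient[where P = word_monoid and H = ?M and h = "M_class gamma W" and \<phi> = "eval f"])
    show "monoid ?M"
      using monoid_epi_image[OF monoid_word_monoid epi] one by simp
    \<comment> \<open>The countable alphabet enters here: the quotient is an image of the set of
      words.\<close>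
    have "carrier ?M = M_class gamma W ` UNIV"
      using epi by (simp add: epi_def)
    then show "countable (carrier ?M)" by simp
    show "M_class gamma W \<in> hom word_monoid ?M"
      using epi by (simp add: epi_def)
    show "eval f u = eval f v" if "M_class gamma W u = M_class gamma W v" for u v
    proof (cases "(u, v) \<in> gamma")
      case True
      then show ?thesis by (rule eval_gamma[OF f])
    next
      case False
      then have "\<not> factor_word gamma W u" "\<not> factor_word gamma W v"
        using that M_class_eq_iff[OF word_congruence_gamma] by blast+
      then show ?thesis
        using zero[of u] zero[of v] by argo
    qed
  qed (use assms(1) M one monoid_word_monoid eval_epi[OF S] in simp_all)
qed

text \<open>Asking for \<open>sep\<close> only when \<open>u\<close> is a factor is enough:
  exchanging \<open>u\<close> and \<open>v\<close> shows that a non-factor cannot share its values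
  with a factor.\<close>

lemma copies_in_M_if_tables:
  fixes U :: "'x::infinite monoid set" and F :: "('l \<Rightarrow> 'b::monoid_mult) set"
  assumes "monoid_variety U" "countable F"
    and "\<And>f. f \<in> F \<Longrightarrow> \<exists>S. range f \<subseteq> S \<and> monoid (table_monoid S) \<and> countable S \<and> copies_in U (table_monoid S)"
    and z: "\<not> factor_word gamma W z"
    and sep: "\<And>u v. \<lbrakk>\<And>f. f \<in> F \<Longrightarrow> eval f u = eval f v; factor_word gamma W u\<rbrakk>
      \<Longrightarrow> factor_word gamma W v \<and> (u, v) \<in> gamma"
  shows "copies_in U (M_monoid gamma (word_classes gamma W))"
proof (rule copies_in_eval_separated[OF assms(1,2,3) M_class_epi[OF word_congruence_gamma z]])
  fix u v
  assume eq: "\<And>f. f \<in> F \<Longrightarrow> eval f u = eval f v"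
  show "M_class gamma W u = M_class gamma W v"
  proof (cases "factor_word gamma W u")
    case True
    then show ?thesis
      using sep[of u v] eq by (simp add: M_class_eq_iff[OF word_congruence_gamma])
  next
    case False
    have "\<not> factor_word gamma W v"
    proof
      assume "factor_word gamma W v"
      with eq[symmetric] have "factor_word gamma W u"
        using sep[of v u] by blast
      with False show False ..
    qed
    with False show ?thesis
      by (simp add: M_class_eq_iff[OF word_congruence_gamma])
  qed
qed

text \<open>Soundness: the relations hold in the table. Completeness: \<open>nf\<close> picks a word
  for each element, and prefixing a letter to a chosen word leads, by the relations, to the chosen
  word of the product; hence every word reduces to the one of its value. The condition
  \<open>not_one\<close> keeps the value 1 for the empty word, which matches the adjoined
  identity.\<close>

lemma presented_semigroup_iso:
  fixes R :: "('g with_zero list \<times> 'g with_zero list) set" and v :: "'g with_zero \<Rightarrow> 'b::monoid_mult"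
  defines "\<theta> \<equiv> generated_congruence (R \<union> zero_relations)"
  assumes R: "\<And>l r. (l, r) \<in> R \<Longrightarrow> eval v l = eval v r"
    and zero: "\<And>x. v Zero * v x = v Zero" "\<And>x. v x * v Zero = v Zero"
    and not_one: "\<And>x q. v x * q \<noteq> 1"
    and S: "monoid (table_monoid S)" "range v \<subseteq> S" "S \<subseteq> range (eval v)"
    and nf: "nf 1 = []" "\<And>x q. q \<in> S \<Longrightarrow> (x # nf q, nf (v x * q)) \<in> generated_congruence (R \<union> zero_relations)"
  shows "table_monoid S \<cong> adjoin_one (presented_semigroup R)"
proof -
  have \<theta>: "word_congruence \<theta>"
    unfolding \<theta>_def by (rule word_congruence_generated)
  define \<pi> where "\<pi> w = (if w = [] then None else Some (\<theta> `` {w}))" for w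
  have carr: "carrier (adjoin_one (presented_semigroup R)) = insert None (Some ` ({w. w \<noteq> []} // \<theta>))"
    by (simp add: adjoin_one_def presented_semigroup_def Let_def \<theta>_def)
  have "\<pi> \<in> hom word_monoid (adjoin_one (presented_semigroup R))"
  proof (rule homI)
    show "\<pi> w \<in> carrier (adjoin_one (presented_semigroup R))" for w
      by (auto simp: carr \<pi>_def quotient_def)
    show "\<pi> (u \<otimes>\<^bsub>word_monoid\<^esub> w) = \<pi> u \<otimes>\<^bsub>adjoin_one (presented_semigroup R)\<^esub> \<pi> w" for u w
      using class_mult_class[OF \<theta>, of u w]
      by (simp add: \<pi>_def adjoin_one_def presented_semigroup_def Let_def flip: \<theta>_def)
  qed
  moreover have "range \<pi> = carrier (adjoin_one (presented_semigroup R))"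
    unfolding carr by (auto simp: \<pi>_def quotient_def image_iff)
  ultimately have \<pi>: "\<pi> \<in> epi word_monoid (adjoin_one (presented_semigroup R))"
    by (simp add: epi_def)
  have sound: "eval v u = eval v w" if "(u, w) \<in> \<theta>" for u w
    using that unfolding \<theta>_def
  proof (induction rule: generated_congruence.induct)
    case (base u w p s)
    then have "eval v u = eval v w"
      using R zero by (auto simp: zero_relations_def)
    then show ?case by simp
  qed auto
  have eval_S: "eval v w \<in> S" for w
    using eval_hom[OF S(1,2)] by (auto simp: hom_def)
  have complete: "(w, nf (eval v w)) \<in> \<theta>" for w
  proof (induction w)
    case Nil
    then show ?case using nf(1) word_congruence_refl[OF \<theta>] by simp
  next
    case (Cons x w)
    have "(x # w, x # nf (eval v w)) \<in> \<theta>"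
      using word_congruence_context[OF \<theta> Cons.IH, of "[x]" "[]"] by simp
    moreover have "(x # nf (eval v w), nf (v x * eval v w)) \<in> \<theta>"
      unfolding \<theta>_def by (rule nf(2)[OF eval_S])
    ultimately show ?case
      using word_congruence_trans[OF \<theta>] by simp
  qed
  have one: "eval v w = 1 \<longleftrightarrow> w = []" for w
    using not_one by (cases w) auto
  have "\<pi> u = \<pi> w \<longleftrightarrow> eval v u = eval v w" for u w
  proof (cases "u = [] \<or> w = []")
    case True
    then show ?thesis
      using one[of u] one[of w] by (auto simp: \<pi>_def)
  next
    case False
    have "(u, w) \<in> \<theta>" if "eval v u = eval v w"
      using complete[of u] complete[of w] that word_congruence_trans[OF \<theta>] word_congruence_sym[OF \<theta>]
      by metis
    with False sound show ?thesis
      by (auto simp: \<pi>_def word_congruence_class_eq_iff[OF \<theta>])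
  qed
  then show ?thesis
    by (intro iso_if_same_kernel[OF monoid_word_monoid eval_epi[OF S] \<pi>]) simp
qed

section \<open>Multiplication tables and the presented semigroups\<close>

datatype b0_table = B_one | B_e | B_f | B_c | B_zero

instantiation b0_table :: "{monoid_mult, mult_zero}"
begin

definition one_b0_table :: b0_table where "1 = B_one"
definition zero_b0_table :: b0_table where "0 = B_zero"

fun times_b0_table :: "b0_table \<Rightarrow> b0_table \<Rightarrow> b0_table" where
  "times_b0_table B_one y = y"
| "times_b0_table x B_one = x"
| "times_b0_table B_e B_e = B_e"
| "times_b0_table B_f B_f = B_f"
| "times_b0_table B_e B_c = B_c"
| "times_b0_table B_c B_f = B_c"
| "times_b0_table _ _ = B_zero"

instance
proof
  fix x y z :: b0_table
  show "x * y * z = x * (y * z)"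
    by (cases x; cases y; cases z; simp)
qed (simp_all add: one_b0_table_def zero_b0_table_def, (metis b0_table.exhaust times_b0_table.simps)+)

end

text \<open>\<open>A_fe\<close> is the product fe, which survives because only ef is set to 0. It
  satisfies x q x = 0 for every q and so plays the part that c has in the other table.\<close>

datatype a0_table = A_one | A_e | A_f | A_fe | A_zero

instantiation a0_table :: "{monoid_mult, mult_zero}"
begin

definition one_a0_table :: a0_table where "1 = A_one"
definition zero_a0_table :: a0_table where "0 = A_zero"

fun times_a0_table :: "a0_table \<Rightarrow> a0_table \<Rightarrow> a0_table" where
  "times_a0_table A_one y = y"
| "times_a0_table x A_one = x"
| "times_a0_table A_e A_e = A_e"
| "times_a0_table A_f A_f = A_f"
| "times_a0_table A_f A_e = A_fe"
| "times_a0_table A_f A_fe = A_fe"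
| "times_a0_table A_fe A_e = A_fe"
| "times_a0_table _ _ = A_zero"

instance
proof
  fix x y z :: a0_table
  show "x * y * z = x * (y * z)"
    by (cases x; cases y; cases z; simp)
qed (simp_all add: one_a0_table_def zero_a0_table_def, (metis a0_table.exhaust times_a0_table.simps)+)

end

lemmas b0_table_defs = one_b0_table_def zero_b0_table_def
lemmas a0_table_defs = one_a0_table_def zero_a0_table_def

lemma UNIV_b0_table: "UNIV = {B_one, B_e, B_f, B_c, B_zero}"
  using b0_table.exhaust by blast

lemma UNIV_a0_table: "UNIV = {A_one, A_e, A_f, A_fe, A_zero}"
  using a0_table.exhaust by blast

text \<open>Copies of \<open>E\<^sup>1\<close> and its dual inside \<open>B\<^sub>0\<^sup>1\<close>; the generator \<open>e\<close> of \<open>E\<close> is \<open>B_f\<close> here.\<close>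

definition E_table :: "b0_table set" where "E_table = {B_one, B_f, B_c, B_zero}"
definition E_op_table :: "b0_table set" where "E_op_table = {B_one, B_e, B_c, B_zero}"

lemma monoid_tables:
  "monoid (table_monoid E_table)" "monoid (table_monoid E_op_table)"
  "monoid (table_monoid (UNIV :: 'b::monoid_mult set))"
  by (rule monoid_table_monoid; force simp: E_table_def E_op_table_def b0_table_defs)+

lemma countable_tables:
  "countable E_table" "countable E_op_table"
  "countable (UNIV :: b0_table set)" "countable (UNIV :: a0_table set)"
  by (simp_all add: E_table_def E_op_table_def UNIV_b0_table UNIV_a0_table)

text \<open>Reversal turns c f = c into f c = c, which is the rule for e in B_0; hence the renaming
  of \<open>B_f\<close> to \<open>B_e\<close>.\<close>

lemma opposite_E_table: "opposite_monoid (table_monoid E_table) \<cong> table_monoid E_op_table"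
proof (rule is_isoI)
  show "(\<lambda>x. if x = B_f then B_e else x) \<in> iso (opposite_monoid (table_monoid E_table)) (table_monoid E_op_table)"
    by (auto simp: iso_iff hom_def inj_on_def E_table_def E_op_table_def image_iff)
qed

text \<open>All four products of two generators are prescribed by relations, so each reduction takes
  a single step.\<close>

lemma adjoin_one_semigroup_E: "table_monoid E_table \<cong> adjoin_one semigroup_E"
  unfolding semigroup_E_def Let_def
proof (rule presented_semigroup_iso)
  define v :: "gens_E with_zero \<Rightarrow> b0_table" where
    "v x = (case x of Zero \<Rightarrow> B_zero | Gen E_e \<Rightarrow> B_f | Gen E_c \<Rightarrow> B_c)" for x
  define nf :: "b0_table \<Rightarrow> gens_E with_zero list" where
    "nf q = (case q of B_one \<Rightarrow> [] | B_f \<Rightarrow> [Gen E_e] | B_c \<Rightarrow> [Gen E_c] | _ \<Rightarrow> [Zero])" for q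
  let ?R = "{([Gen E_e, Gen E_e], [Gen E_e]), ([Gen E_c, Gen E_c], [Zero]),
      ([Gen E_e, Gen E_c], [Zero]), ([Gen E_c, Gen E_e], [Gen E_c])}"
  have v: "v Zero = B_zero" "v (Gen E_e) = B_f" "v (Gen E_c) = B_c"
    by (simp_all add: v_def)
  have x: "x = Zero \<or> x = Gen E_e \<or> x = Gen E_c" for x :: "gens_E with_zero"
    by (metis gens_E.exhaust with_zero.exhaust)
  show "eval v l = eval v r" if "(l, r) \<in> ?R" for l r
    using that by (auto simp: v b0_table_defs)
  show "v Zero * v x = v Zero" "v x * v Zero = v Zero" for x
    using x[of x] by (auto simp: v)
  show "v x * q \<noteq> 1" for x q
    using x[of x] by (cases q) (auto simp: v b0_table_defs)
  show "monoid (table_monoid E_table)" by (rule monoid_tables)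
  have "v x \<in> E_table" for x
    using x[of x] by (auto simp: v E_table_def)
  then show "range v \<subseteq> E_table" by blast
  have "eval v [] = B_one" "eval v [Gen E_e] = B_f" "eval v [Gen E_c] = B_c" "eval v [Zero] = B_zero"
    by (simp_all add: v one_b0_table_def)
  then show "E_table \<subseteq> range (eval v)"
    unfolding E_table_def by (metis (no_types, lifting) empty_subsetI insert_subset rangeI)
  show "nf 1 = []"
    by (simp add: nf_def one_b0_table_def)
  define \<theta> where "\<theta> = generated_congruence (?R \<union> zero_relations)"
  have "(l, r) \<in> ?R \<union> zero_relations \<Longrightarrow> (l, r) \<in> \<theta>" for l r
    unfolding \<theta>_def using generated_congruence.base[of l r _ "[]" "[]"] by simp
  then have base: "(l, r) \<in> ?R \<Longrightarrow> (l, r) \<in> \<theta>"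
    and zero: "([Zero, x], [Zero]) \<in> \<theta>" "([x, Zero], [Zero]) \<in> \<theta>" for l r x
    by (auto simp: zero_relations_def)
  have refl: "(u, u) \<in> \<theta>" for u
    unfolding \<theta>_def by (rule generated_congruence.refl)
  show "(x # nf q, nf (v x * q)) \<in> generated_congruence (?R \<union> zero_relations)" if "q \<in> E_table" for x q
    using that x[of x] unfolding E_table_def \<theta>_def[symmetric]
    by (elim insertE disjE emptyE) (auto simp: v nf_def intro: base zero refl)
qed


lemma adjoin_one_semigroup_B0: "table_monoid (UNIV :: b0_table set) \<cong> adjoin_one semigroup_B0"
  unfolding semigroup_B0_def Let_def
proof (rule presented_semigroup_iso)
  define v :: "gens_B0 with_zero \<Rightarrow> b0_table" where
    "v x = (case x of Zero \<Rightarrow> B_zero | Gen B0_e \<Rightarrow> B_e | Gen B0_f \<Rightarrow> B_f | Gen B0_c \<Rightarrow> B_c)" for x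
  define nf :: "b0_table \<Rightarrow> gens_B0 with_zero list" where
    "nf q = (case q of B_one \<Rightarrow> [] | B_e \<Rightarrow> [Gen B0_e] | B_f \<Rightarrow> [Gen B0_f] | B_c \<Rightarrow> [Gen B0_c]
      | B_zero \<Rightarrow> [Zero])" for q
  let ?e = "Gen B0_e" and ?f = "Gen B0_f" and ?c = "Gen B0_c"
  let ?R = "{([?e, ?e], [?e]), ([?f, ?f], [?f]), ([?e, ?f], [Zero]), ([?f, ?e], [Zero]),
      ([?e, ?c], [?c]), ([?c, ?f], [?c])}"
  have v: "v Zero = B_zero" "v ?e = B_e" "v ?f = B_f" "v ?c = B_c"
    by (simp_all add: v_def)
  have x: "x = Zero \<or> x = ?e \<or> x = ?f \<or> x = ?c" for x :: "gens_B0 with_zero"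
    by (metis gens_B0.exhaust with_zero.exhaust)
  show "eval v l = eval v r" if "(l, r) \<in> ?R" for l r
    using that by (auto simp: v b0_table_defs)
  show "v Zero * v x = v Zero" "v x * v Zero = v Zero" for x
    using x[of x] by (auto simp: v)
  show "v x * q \<noteq> 1" for x q
    using x[of x] by (cases q) (auto simp: v b0_table_defs)
  show "monoid (table_monoid (UNIV :: b0_table set))" by (rule monoid_tables)
  show "range v \<subseteq> UNIV" by simp
  have "eval v [] = B_one" "eval v [?e] = B_e" "eval v [?f] = B_f" "eval v [?c] = B_c" "eval v [Zero] = B_zero"
    by (simp_all add: v one_b0_table_def)
  then show "UNIV \<subseteq> range (eval v)"
    unfolding UNIV_b0_table by (metis (no_types, lifting) empty_subsetI insert_subset rangeI)
  show "nf 1 = []"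
    by (simp add: nf_def one_b0_table_def)
  define \<theta> where "\<theta> = generated_congruence (?R \<union> zero_relations)"
  have "(l, r) \<in> ?R \<union> zero_relations \<Longrightarrow> (l, r) \<in> \<theta>" for l r
    unfolding \<theta>_def using generated_congruence.base[of l r _ "[]" "[]"] by simp
  then have base: "(l, r) \<in> ?R \<Longrightarrow> (l, r) \<in> \<theta>"
    and zero: "([Zero, x], [Zero]) \<in> \<theta>" "([x, Zero], [Zero]) \<in> \<theta>" for l r x
    by (auto simp: zero_relations_def)
  have \<theta>: "word_congruence \<theta>" unfolding \<theta>_def by (rule word_congruence_generated)
  have step: "(u, w) \<in> \<theta>" if "(l, r) \<in> \<theta>" "u = p @ l @ s" "(p @ r @ s, w) \<in> \<theta>" for l r p s u w
    using word_congruence_context[OF \<theta> that(1)] that(2,3) word_congruence_trans[OF \<theta>] by blast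
  \<comment> \<open>The products fc, ce and cc are not among the relations; they vanish by fc = fec,
    ce = cfe and cc = cfc.\<close>
  have fc: "([?f, ?c], [Zero]) \<in> \<theta>"
  proof (rule step[where p = "[?f]" and l = "[?c]" and r = "[?e, ?c]" and s = "[]"])
    show "([?c], [?e, ?c]) \<in> \<theta>" by (rule word_congruence_sym[OF \<theta> base]) simp
    show "([?f] @ [?e, ?c] @ [], [Zero]) \<in> \<theta>"
      by (rule step[where p = "[]" and l = "[?f, ?e]" and r = "[Zero]" and s = "[?c]"])
        (auto intro: base zero)
  qed simp
  have ce: "([?c, ?e], [Zero]) \<in> \<theta>"
  proof (rule step[where p = "[]" and l = "[?c]" and r = "[?c, ?f]" and s = "[?e]"])
    show "([?c], [?c, ?f]) \<in> \<theta>" by (rule word_congruence_sym[OF \<theta> base]) simp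
    show "([] @ [?c, ?f] @ [?e], [Zero]) \<in> \<theta>"
      by (rule step[where p = "[?c]" and l = "[?f, ?e]" and r = "[Zero]" and s = "[]"])
        (auto intro: base zero)
  qed simp
  have cc: "([?c, ?c], [Zero]) \<in> \<theta>"
  proof (rule step[where p = "[]" and l = "[?c]" and r = "[?c, ?f]" and s = "[?c]"])
    show "([?c], [?c, ?f]) \<in> \<theta>" by (rule word_congruence_sym[OF \<theta> base]) simp
    show "([] @ [?c, ?f] @ [?c], [Zero]) \<in> \<theta>"
      by (rule step[where p = "[?c]" and l = "[?f, ?c]" and r = "[Zero]" and s = "[]"])
        (auto intro: fc zero)
  qed simp
  show "(x # nf q, nf (v x * q)) \<in> generated_congruence (?R \<union> zero_relations)" for x q
    using x[of x] unfolding \<theta>_def[symmetric]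
    by (cases q; elim disjE)
      (auto simp: v nf_def intro: zero fc ce cc base word_congruence_refl[OF \<theta>])
qed

lemma adjoin_one_semigroup_A0: "table_monoid (UNIV :: a0_table set) \<cong> adjoin_one semigroup_A0"
  unfolding semigroup_A0_def Let_def
proof (rule presented_semigroup_iso)
  define v :: "gens_A0 with_zero \<Rightarrow> a0_table" where
    "v x = (case x of Zero \<Rightarrow> A_zero | Gen A0_e \<Rightarrow> A_e | Gen A0_f \<Rightarrow> A_f)" for x
  let ?e = "Gen A0_e" and ?f = "Gen A0_f"
  define nf :: "a0_table \<Rightarrow> gens_A0 with_zero list" where
    "nf q = (case q of A_one \<Rightarrow> [] | A_e \<Rightarrow> [?e] | A_f \<Rightarrow> [?f] | A_fe \<Rightarrow> [?f, ?e]
      | A_zero \<Rightarrow> [Zero])" for q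
  let ?R = "{([?e, ?e], [?e]), ([?f, ?f], [?f]), ([?e, ?f], [Zero])}"
  have v: "v Zero = A_zero" "v ?e = A_e" "v ?f = A_f"
    by (simp_all add: v_def)
  have x: "x = Zero \<or> x = ?e \<or> x = ?f" for x :: "gens_A0 with_zero"
    by (metis gens_A0.exhaust with_zero.exhaust)
  show "eval v l = eval v r" if "(l, r) \<in> ?R" for l r
    using that by (auto simp: v a0_table_defs)
  show "v Zero * v x = v Zero" "v x * v Zero = v Zero" for x
    using x[of x] by (auto simp: v)
  show "v x * q \<noteq> 1" for x q
    using x[of x] by (cases q) (auto simp: v a0_table_defs)
  show "monoid (table_monoid (UNIV :: a0_table set))" by (rule monoid_tables)
  show "range v \<subseteq> UNIV" by simp
  have "eval v [] = A_one" "eval v [?e] = A_e" "eval v [?f] = A_f" "eval v [?f, ?e] = A_fe" "eval v [Zero] = A_zero"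
    by (simp_all add: v one_a0_table_def)
  then show "UNIV \<subseteq> range (eval v)"
    unfolding UNIV_a0_table by (metis (no_types, lifting) empty_subsetI insert_subset rangeI)
  show "nf 1 = []"
    by (simp add: nf_def one_a0_table_def)
  define \<theta> where "\<theta> = generated_congruence (?R \<union> zero_relations)"
  have "(l, r) \<in> ?R \<union> zero_relations \<Longrightarrow> (l, r) \<in> \<theta>" for l r
    unfolding \<theta>_def using generated_congruence.base[of l r _ "[]" "[]"] by simp
  then have base: "(l, r) \<in> ?R \<Longrightarrow> (l, r) \<in> \<theta>"
    and zero: "([Zero, x], [Zero]) \<in> \<theta>" "([x, Zero], [Zero]) \<in> \<theta>" for l r x
    by (auto simp: zero_relations_def)
  have \<theta>: "word_congruence \<theta>" unfolding \<theta>_def by (rule word_congruence_generated)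
  have step: "(u, w) \<in> \<theta>" if "(l, r) \<in> \<theta>" "u = p @ l @ s" "(p @ r @ s, w) \<in> \<theta>" for l r p s u w
    using word_congruence_context[OF \<theta> that(1)] that(2,3) word_congruence_trans[OF \<theta>] by blast
  \<comment> \<open>The element fe has a normal form of two letters, so prefixing a letter to it
    produces three words of length three to reduce.\<close>
  have efe: "([?e, ?f, ?e], [Zero]) \<in> \<theta>"
    by (rule step[where p = "[]" and l = "[?e, ?f]" and r = "[Zero]" and s = "[?e]"])
      (auto intro: base zero)
  have zfe: "([Zero, ?f, ?e], [Zero]) \<in> \<theta>"
    by (rule step[where p = "[]" and l = "[Zero, ?f]" and r = "[Zero]" and s = "[?e]"])
      (auto intro: zero)
  have ffe: "([?f, ?f, ?e], [?f, ?e]) \<in> \<theta>"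
    by (rule step[where p = "[]" and l = "[?f, ?f]" and r = "[?f]" and s = "[?e]"])
      (auto intro: base word_congruence_refl[OF \<theta>])
  show "(x # nf q, nf (v x * q)) \<in> generated_congruence (?R \<union> zero_relations)" for x q
    using x[of x] unfolding \<theta>_def[symmetric]
    by (cases q; elim disjE)
      (auto simp: v nf_def intro: zero efe zfe ffe base word_congruence_refl[OF \<theta>])
qed

lemma copies_in_B0_table:
  fixes U :: "'x::infinite monoid set"
  assumes U: "monoid_variety U"
  shows "copies_in U (table_monoid (UNIV :: b0_table set)) \<longleftrightarrow>
    copies_in U (table_monoid E_table) \<and> copies_in U (table_monoid E_op_table)"
proof (intro iffI conjI)
  assume B0: "copies_in U (table_monoid (UNIV :: b0_table set))"
  have "copies_in U (table_monoid S)" if "monoid (table_monoid S)" for S :: "b0_table set"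
    by (rule copies_in_quotient[OF U that _ _ B0, where h = "\<lambda>x. x" and \<phi> = "\<lambda>x. x"])
      (use monoid.m_closed[OF that] in \<open>auto simp: monoid_tables countable_tables hom_def epi_def\<close>)
  then show "copies_in U (table_monoid E_table)" "copies_in U (table_monoid E_op_table)"
    by (simp_all add: monoid_tables)
next
  assume E: "copies_in U (table_monoid E_table) \<and> copies_in U (table_monoid E_op_table)"
  \<comment> \<open>\<open>B\<^sub>0\<^sup>1\<close> divides the product of \<open>E\<^sup>1\<close> and its dual: \<open>k1\<close> detects an \<open>f\<close> before
    a \<open>c\<close>, \<open>k2\<close> an \<open>e\<close> after a \<open>c\<close>, and \<open>g\<close> recovers the value of the word.\<close>
  define k1 where "k1 x = (if x = B_e then B_one else x)" for x
  define k2 where "k2 x = (if x = B_f then B_one else x)" for x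
  define g where "g x y = (if x = B_one then if y = B_one then B_one else if y = B_e then B_e else B_zero
    else if x = B_f \<and> y = B_one then B_f else if x = B_c \<and> y = B_c then B_c else B_zero)" for x y
  have range: "range k1 \<subseteq> E_table" "range k2 \<subseteq> E_op_table"
    by (auto simp: k1_def k2_def E_table_def E_op_table_def) (metis b0_table.exhaust)+
  \<comment> \<open>The words grow on the left, as in the induction below. The restriction on
    \<open>z\<close> matters: for \<open>x = B_c\<close>, \<open>y = B_one\<close>,
    \<open>z = B_f\<close> the left side is \<open>B_zero\<close> and the right side
    \<open>B_c\<close>.\<close>
  have step: "x * g y z = g (k1 x * y) (k2 x * z)" if "z \<in> E_op_table" for x y z
    using that by (cases x; cases y; cases z) (simp_all add: k1_def k2_def g_def E_op_table_def)
  have "eval k2 u \<in> E_op_table" for u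
    using eval_hom[OF monoid_tables(2) range(2)] by (auto simp: hom_def)
  then have eval: "eval (\<lambda>x. x) u = g (eval k1 u) (eval k2 u)" for u :: "b0_table list"
    by (induction u) (simp_all add: step, simp add: g_def one_b0_table_def)
  show "copies_in U (table_monoid (UNIV :: b0_table set))"
  proof (rule copies_in_eval_separated[OF U, where F = "{k1, k2}" and \<phi> = "eval (\<lambda>x. x)"])
    show "\<exists>S. range f \<subseteq> S \<and> monoid (table_monoid S) \<and> countable S \<and> copies_in U (table_monoid S)"
      if "f \<in> {k1, k2}" for f
      using that range monoid_tables countable_tables E by blast
    have "x = eval (\<lambda>x. x) [x]" for x :: b0_table by simp
    then show "eval (\<lambda>x. x) \<in> epi word_monoid (table_monoid (UNIV :: b0_table set))"
      by (intro eval_epi monoid_tables) blast+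
    show "eval (\<lambda>x. x) u = eval (\<lambda>x. x) v" if "\<And>f. f \<in> {k1, k2} \<Longrightarrow> eval f u = eval f v" for u v
      using that[of k1] that[of k2] by (simp add: eval)
  qed simp
qed

section \<open>Assignments of two letters\<close>

text \<open>The default 0 makes a nonzero value confine a word to the two letters.\<close>

definition letters2 :: "'l \<Rightarrow> 'b \<Rightarrow> 'l \<Rightarrow> 'b \<Rightarrow> 'l \<Rightarrow> 'b::zero" where
  "letters2 a x b y z = (if z = a then x else if z = b then y else 0)"

lemma range_letters2: "x \<in> S \<Longrightarrow> y \<in> S \<Longrightarrow> 0 \<in> S \<Longrightarrow> range (letters2 a x b y) \<subseteq> S"
  by (auto simp: letters2_def)

lemma letters2_gamma:
  fixes x y :: "'b::{monoid_mult, mult_zero}"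
  assumes "x * x = x \<or> (\<forall>q. x * q * x = 0)" "y * y = y \<or> (\<forall>q. y * q * y = 0)"
  shows "letters2 a x b y z * letters2 a x b y z = letters2 a x b y z \<or>
    (\<forall>q. letters2 a x b y z * q * letters2 a x b y z = 0)"
  using assms by (auto simp: letters2_def)

lemma b0_table_0_1 [simp]: "(0 :: b0_table) = B_zero" "(1 :: b0_table) = B_one"
  by (rule zero_b0_table_def one_b0_table_def)+

lemma a0_table_0_1 [simp]: "(0 :: a0_table) = A_zero" "(1 :: a0_table) = A_one"
  by (rule zero_a0_table_def one_a0_table_def)+

lemma B_c_nil: "B_c * q * B_c = B_zero"
  by (cases q) simp_all

lemma times_tables_simps [simp]:
  "B_zero * x = B_zero" "x * B_zero = B_zero" "x * B_one = x"
  "A_zero * y = A_zero" "y * A_zero = A_zero" "y * A_one = y"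
  by (cases x; simp; fail | cases y; simp; fail)+

text \<open>The powers of \<open>B_c\<close> and \<open>A_fe\<close> determine \<open>n\<close>
  exactly up to \<open>min 2 n\<close>, the precision at which \<open>gamma\<close> counts
  letters.\<close>

lemma power_tables [simp]:
  "B_one ^ n = B_one" "B_e ^ n = (if n = 0 then B_one else B_e)" "B_f ^ n = (if n = 0 then B_one else B_f)"
  "B_c ^ n = (if n = 0 then B_one else if n = 1 then B_c else B_zero)"
  "A_one ^ n = A_one" "A_e ^ n = (if n = 0 then A_one else A_e)" "A_f ^ n = (if n = 0 then A_one else A_f)"
  "A_fe ^ n = (if n = 0 then A_one else if n = 1 then A_fe else A_zero)"
  by (induction n) auto

lemma count_list_replicate: "count_list (replicate n x) y = (if x = y then n else 0)"
  by (induction n) auto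

lemma replicate_append_two: "replicate n x @ [x, x] = x # x # replicate n x"
  by (induction n) simp_all

lemma gamma_replicate: "min 2 m = min 2 n \<Longrightarrow> (replicate m x, replicate n x) \<in> gamma"
  by (auto simp: gamma_iff remdups_adj_replicate count_list_replicate min_def split: if_splits)

lemma gamma_append: "(u, u') \<in> gamma \<Longrightarrow> (v, v') \<in> gamma \<Longrightarrow> (u @ v, u' @ v') \<in> gamma"
  by (rule word_congruence_append[OF word_congruence_gamma])

lemma gamma_refl: "(u, u) \<in> gamma"
  by (rule word_congruence_refl[OF word_congruence_gamma])

lemma remdups_adj_replicate_append:
  "0 < n \<Longrightarrow> remdups_adj (replicate n x @ s) = remdups_adj (x # s)"
proof (induction n)
  case (Suc n)
  then show ?case by (cases n) simp_all
qed simp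

text \<open>An \<open>a\<close> on each side of \<open>t\<close> already makes \<open>a\<close>
  multiple, so the exponents have no influence.\<close>

lemma gamma_ata:
  assumes "a \<noteq> t" "0 < m" "0 < n" "0 < m'" "0 < n'"
  shows "(replicate m a @ t # replicate n a, replicate m' a @ t # replicate n' a) \<in> gamma"
  using assms
  by (auto simp: gamma_iff remdups_adj_replicate_append remdups_adj_Cons remdups_adj_replicate
      count_list_replicate)

text \<open>Zero absorbs, so the tail of the word has the form by induction. A second
  \<open>t\<close> is excluded by c c = 0, and an \<open>a\<close> before \<open>t\<close> by f c =
  0.\<close>

lemma form_ta:
  assumes "a \<noteq> t"
  shows "eval (letters2 t B_c a B_f) u \<noteq> B_zero \<Longrightarrow> \<exists>n. u = replicate n a \<or> u = t # replicate n a"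
proof (induction u)
  case (Cons x u)
  then obtain n where n: "u = replicate n a \<or> u = t # replicate n a"
    by fastforce
  have "x = a \<and> u = replicate n a \<or> x = t \<and> u = replicate n a"
    using n Cons.prems assms by (auto simp: letters2_def split: if_splits)
  then show ?case
    by (metis replicate_Suc)
qed (intro exI[of _ 0], simp)

lemma form_at:
  assumes "a \<noteq> t"
  shows "eval (letters2 t B_c a B_e) u \<noteq> B_zero \<Longrightarrow> \<exists>n. u = replicate n a \<or> u = replicate n a @ [t]"
proof (induction u)
  case (Cons x u)
  then obtain n where n: "u = replicate n a \<or> u = replicate n a @ [t]"
    by fastforce
  have "x = a \<or> x = t \<and> u = []"
    using n Cons.prems assms by (auto simp: letters2_def split: if_splits)
  then show ?case
    using n by (metis append_Cons append_Nil replicate_0 replicate_Suc)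
qed (intro exI[of _ 0], simp)

text \<open>With \<open>a\<close> sent to the identity, only a second \<open>t\<close> is
  excluded.\<close>

lemma form_ata:
  assumes "a \<noteq> t"
  shows "eval (letters2 t B_c a B_one) u \<noteq> B_zero \<Longrightarrow>
    \<exists>m n. u = replicate m a \<or> u = replicate m a @ t # replicate n a"
proof (induction u)
  case (Cons x u)
  then obtain m n where mn: "u = replicate m a \<or> u = replicate m a @ t # replicate n a"
    by fastforce
  have "x = a \<or> x = t \<and> u = replicate m a"
    using mn Cons.prems assms by (auto simp: letters2_def split: if_splits)
  then show ?case
    using mn by (metis append_Cons append_Nil replicate_0 replicate_Suc)
qed (intro exI[of _ 0], simp)

text \<open>Since e f = 0, no \<open>b\<close> can precede an \<open>a\<close>.\<close>

lemma form_ab: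
  assumes "a \<noteq> b"
  shows "eval (letters2 a A_f b A_e) u \<noteq> A_zero \<Longrightarrow> \<exists>m n. u = replicate m a @ replicate n b"
proof (induction u)
  case (Cons x u)
  then obtain m n where mn: "u = replicate m a @ replicate n b"
    by fastforce
  have "x = a \<or> x = b \<and> m = 0"
    using mn Cons.prems assms by (auto simp: letters2_def split: if_splits)
  then show ?case
    using mn by (metis append_Cons append_Nil replicate_0 replicate_Suc)
qed (intro exI[of _ 0], simp)

lemma factor_word_insert:
  "factor_word \<tau> (insert w W) u \<longleftrightarrow> factor_word \<tau> {w} u \<or> factor_word \<tau> W u"
  by (auto simp: factor_word_def)

lemma factor_wordI: "(p @ u @ s, w) \<in> \<tau> \<Longrightarrow> w \<in> W \<Longrightarrow> factor_word \<tau> W u"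
  by (auto simp: factor_word_def)

lemma factor_ta:
  assumes "a \<noteq> t"
  shows "factor_word gamma {[t, a, a]} u \<longleftrightarrow> eval (letters2 t B_c a B_f) u \<noteq> B_zero"
proof
  assume "factor_word gamma {[t, a, a]} u"
  then obtain p s where ps: "(p @ u @ s, [t, a, a]) \<in> gamma"
    by (auto simp: factor_word_def)
  have "eval (letters2 t B_c a B_f) u \<noteq> 0"
    by (rule eval_factor_nonzero[OF letters2_gamma ps]) (use assms in \<open>auto simp: B_c_nil letters2_def\<close>)
  then show "eval (letters2 t B_c a B_f) u \<noteq> B_zero" by simp
next
  assume "eval (letters2 t B_c a B_f) u \<noteq> B_zero"
  then obtain n where n: "u = replicate n a \<or> u = t # replicate n a"
    using form_ta[OF assms] by blast
  \<comment> \<open>Padding with two more letters makes \<open>a\<close> multiple for every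
    \<open>n\<close>, including 0.\<close>
  have *: "([t] @ replicate (n + 2) a, [t] @ replicate 2 a) \<in> gamma"
    by (intro gamma_append gamma_refl gamma_replicate) simp
  have "([t] @ replicate n a @ [a, a], [t, a, a]) \<in> gamma"
    using * by (simp add: replicate_append_two numeral_2_eq_2)
  then show "factor_word gamma {[t, a, a]} u"
    using n factor_wordI[of "[t]" u "[a, a]"] factor_wordI[of "[]" u "[a, a]"] by auto
qed

lemma factor_at:
  assumes "a \<noteq> t"
  shows "factor_word gamma {[a, a, t]} u \<longleftrightarrow> eval (letters2 t B_c a B_e) u \<noteq> B_zero"
proof
  assume "factor_word gamma {[a, a, t]} u"
  then obtain p s where ps: "(p @ u @ s, [a, a, t]) \<in> gamma"
    by (auto simp: factor_word_def)
  have "eval (letters2 t B_c a B_e) u \<noteq> 0"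
    by (rule eval_factor_nonzero[OF letters2_gamma ps]) (use assms in \<open>auto simp: B_c_nil letters2_def\<close>)
  then show "eval (letters2 t B_c a B_e) u \<noteq> B_zero" by simp
next
  assume "eval (letters2 t B_c a B_e) u \<noteq> B_zero"
  then obtain n where n: "u = replicate n a \<or> u = replicate n a @ [t]"
    using form_at[OF assms] by blast
  have "(replicate (2 + n) a @ [t], replicate 2 a @ [t]) \<in> gamma"
    by (intro gamma_append gamma_refl gamma_replicate) simp
  then have "([a, a] @ replicate n a @ [t], [a, a, t]) \<in> gamma"
    by (simp add: numeral_2_eq_2)
  then show "factor_word gamma {[a, a, t]} u"
    using n factor_wordI[of "[a, a]" u "[t]"] factor_wordI[of "[a, a]" u "[]"] by auto
qed

lemma factor_ata:
  assumes "a \<noteq> t"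
  shows "factor_word gamma {[a, t, a]} u \<longleftrightarrow> eval (letters2 t B_c a B_one) u \<noteq> B_zero"
proof
  assume "factor_word gamma {[a, t, a]} u"
  then obtain p s where ps: "(p @ u @ s, [a, t, a]) \<in> gamma"
    by (auto simp: factor_word_def)
  have "eval (letters2 t B_c a B_one) u \<noteq> 0"
    by (rule eval_factor_nonzero[OF letters2_gamma ps]) (use assms in \<open>auto simp: B_c_nil letters2_def\<close>)
  then show "eval (letters2 t B_c a B_one) u \<noteq> B_zero" by simp
next
  assume "eval (letters2 t B_c a B_one) u \<noteq> B_zero"
  then obtain m n where mn: "u = replicate m a \<or> u = replicate m a @ t # replicate n a"
    using form_ata[OF assms] by blast
  \<comment> \<open>Padding with an \<open>a\<close> on each side makes both exponents positive,
    where \<open>gamma_ata\<close> applies.\<close>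
  have *: "(replicate (Suc m) a @ t # replicate k a, replicate 1 a @ t # replicate 1 a) \<in> gamma" if "0 < k" for k
    using that by (intro gamma_ata[OF assms]) auto
  have "([a] @ (replicate m a @ t # replicate n a) @ [a], [a, t, a]) \<in> gamma"
    using *[of "n + 1"] by (simp add: replicate_append_same)
  moreover have "([a] @ replicate m a @ [t, a], [a, t, a]) \<in> gamma"
    using *[of 1] by simp
  ultimately show "factor_word gamma {[a, t, a]} u"
    using mn factor_wordI[of "[a]" u "[t, a]"] factor_wordI[of "[a]" u "[a]"] by auto
qed

lemma factor_ab:
  assumes "a \<noteq> b"
  shows "factor_word gamma {[a, a, b, b]} u \<longleftrightarrow> eval (letters2 a A_f b A_e) u \<noteq> A_zero"
proof
  assume "factor_word gamma {[a, a, b, b]} u"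
  then obtain p s where ps: "(p @ u @ s, [a, a, b, b]) \<in> gamma"
    by (auto simp: factor_word_def)
  have "eval (letters2 a A_f b A_e) u \<noteq> 0"
    by (rule eval_factor_nonzero[OF letters2_gamma ps]) (use assms in \<open>auto simp: letters2_def\<close>)
  then show "eval (letters2 a A_f b A_e) u \<noteq> A_zero" by simp
next
  assume "eval (letters2 a A_f b A_e) u \<noteq> A_zero"
  then obtain m n where mn: "u = replicate m a @ replicate n b"
    using form_ab[OF assms] by blast
  have "(replicate (2 + m) a @ replicate (n + 2) b, replicate 2 a @ replicate 2 b) \<in> gamma"
    by (intro gamma_append gamma_replicate) simp_all
  then have "([a, a] @ u @ [b, b], [a, a, b, b]) \<in> gamma"
    by (simp add: mn replicate_append_two numeral_2_eq_2)
  then show "factor_word gamma {[a, a, b, b]} u"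
    by (rule factor_wordI) simp
qed

text \<open>The first assignment gives \<open>B_c\<close> exactly when \<open>t\<close> occurs in
  such a word; the second gives the capped exponent of \<open>a\<close>.\<close>

lemma gamma_ta:
  assumes at: "a \<noteq> t" and u: "eval (letters2 t B_c a B_f) u \<noteq> B_zero"
    and eq: "eval (letters2 t B_c a B_f) u = eval (letters2 t B_c a B_f) v"
      "eval (letters2 a B_c t B_one) u = eval (letters2 a B_c t B_one) v"
  shows "(u, v) \<in> gamma"
proof -
  obtain m n where "u = replicate m a \<or> u = t # replicate m a" "v = replicate n a \<or> v = t # replicate n a"
    using form_ta[OF at] u eq(1) by metis
  moreover have "min 2 m = min 2 n \<Longrightarrow> (t # replicate m a, t # replicate n a) \<in> gamma"
    using gamma_append[OF gamma_refl[of "[t]"] gamma_replicate[of m n a]] by simp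
  ultimately show ?thesis
    using eq at gamma_replicate[of m n a] by (auto simp: letters2_def split: if_splits)
qed

lemma gamma_at:
  assumes at: "a \<noteq> t" and u: "eval (letters2 t B_c a B_e) u \<noteq> B_zero"
    and eq: "eval (letters2 t B_c a B_e) u = eval (letters2 t B_c a B_e) v"
      "eval (letters2 a B_c t B_one) u = eval (letters2 a B_c t B_one) v"
  shows "(u, v) \<in> gamma"
proof -
  obtain m n where "u = replicate m a \<or> u = replicate m a @ [t]" "v = replicate n a \<or> v = replicate n a @ [t]"
    using form_at[OF at] u eq(1) by metis
  moreover have "min 2 m = min 2 n \<Longrightarrow> (replicate m a @ [t], replicate n a @ [t]) \<in> gamma"
    using gamma_append[OF gamma_replicate[of m n a] gamma_refl[of "[t]"]] by simp
  ultimately show ?thesis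
    using eq at gamma_replicate[of m n a] by (auto simp: letters2_def split: if_splits)
qed


section \<open>The varieties of the Rees quotients\<close>

lemma E_tables_mem:
  "B_one \<in> E_table" "B_f \<in> E_table" "B_c \<in> E_table" "B_zero \<in> E_table"
  "B_one \<in> E_op_table" "B_e \<in> E_op_table" "B_c \<in> E_op_table" "B_zero \<in> E_op_table"
  by (simp_all add: E_table_def E_op_table_def)

lemma range_eval_ta:
  assumes "a \<noteq> t"
  shows "E_table \<subseteq> range (eval (letters2 t B_c a B_f))" "E_op_table \<subseteq> range (eval (letters2 t B_c a B_e))"
proof -
  let ?f = "letters2 t B_c a B_f" and ?e = "letters2 t B_c a B_e"
  have "B_one = eval ?f []" "B_f = eval ?f [a]" "B_c = eval ?f [t]" "B_zero = eval ?f [a, t]"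
    "B_one = eval ?e []" "B_e = eval ?e [a]" "B_c = eval ?e [t]" "B_zero = eval ?e [t, a]"
    using assms by (simp_all add: letters2_def)
  then show "E_table \<subseteq> range (eval ?f)" "E_op_table \<subseteq> range (eval ?e)"
    unfolding E_table_def E_op_table_def by blast+
qed

text \<open>Stated for any \<open>W\<close> having all factors of ta^+, so that it also covers the
  pair of classes and a^+ta^+.\<close>

lemma E_table_if_M:
  fixes U :: "'x::infinite monoid set" and a t :: "'l::countable"
  assumes U: "monoid_variety U" and at: "a \<noteq> t"
    and M: "copies_in U (M_monoid gamma (word_classes gamma W))"
    and z: "\<not> factor_word gamma W z"
    and W: "\<And>u. factor_word gamma {[t, a, a]} u \<Longrightarrow> factor_word gamma W u"
  shows "copies_in U (table_monoid E_table)"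
proof (rule copies_in_table_if_M[OF U M z, where f = "letters2 t B_c a B_f"])
  show "eval (letters2 t B_c a B_f) u \<noteq> 0 \<Longrightarrow> factor_word gamma W u" for u
    using W[of u] factor_ta[OF at] by simp
qed (rule letters2_gamma range_letters2 range_eval_ta[OF at] monoid_tables
  | simp add: B_c_nil E_tables_mem)+

lemma E_op_table_if_M:
  fixes U :: "'x::infinite monoid set" and a t :: "'l::countable"
  assumes U: "monoid_variety U" and at: "a \<noteq> t"
    and M: "copies_in U (M_monoid gamma (word_classes gamma W))"
    and z: "\<not> factor_word gamma W z"
    and W: "\<And>u. factor_word gamma {[a, a, t]} u \<Longrightarrow> factor_word gamma W u"
  shows "copies_in U (table_monoid E_op_table)"
proof (rule copies_in_table_if_M[OF U M z, where f = "letters2 t B_c a B_e"])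
  show "eval (letters2 t B_c a B_e) u \<noteq> 0 \<Longrightarrow> factor_word gamma W u" for u
    using W[of u] factor_at[OF at] by simp
qed (rule letters2_gamma range_letters2 range_eval_ta[OF at] monoid_tables
  | simp add: B_c_nil E_tables_mem)+

lemma letters_E_table:
  fixes a t :: 'l
  assumes "f \<in> {letters2 t B_c a B_f, letters2 a B_c t B_one, letters2 t B_c a B_one}"
  shows "range f \<subseteq> E_table"
  using assms by (auto simp: letters2_def E_tables_mem)

lemma letters_E_op_table:
  fixes a t :: 'l
  assumes "f \<in> {letters2 t B_c a B_e, letters2 a B_c t B_one, letters2 t B_c a B_one}"
  shows "range f \<subseteq> E_op_table"
  using assms by (auto simp: letters2_def E_tables_mem)

lemma copies_in_M_ta:
  fixes U :: "'x::infinite monoid set" and a t :: "'l::countable"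
  assumes U: "monoid_variety U" and at: "a \<noteq> t"
  shows "copies_in U (M_monoid gamma (word_classes gamma {[t, a, a]})) \<longleftrightarrow> copies_in U (table_monoid E_table)"
    (is "copies_in U ?M \<longleftrightarrow> _")
proof
  \<comment> \<open>The letter \<open>t\<close> occurs once in the generating word, so its square
    reaches the zero of the quotient.\<close>
  have z: "\<not> factor_word gamma {[t, a, a]} [t, t]"
    by (simp add: factor_ta[OF at] letters2_def)
  then show "copies_in U (table_monoid E_table)" if "copies_in U ?M"
    by (rule E_table_if_M[OF U at that]) simp
  assume E: "copies_in U (table_monoid E_table)"
  let ?F = "{letters2 t B_c a B_f, letters2 a B_c t B_one}"
  show "copies_in U ?M"
  proof (rule copies_in_M_if_tables[OF U, where F = ?F])
    show "\<exists>S. range f \<subseteq> S \<and> monoid (table_monoid S) \<and> countable S \<and> copies_in U (table_monoid S)"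
      if "f \<in> ?F" for f
      using that letters_E_table[of f t a] monoid_tables countable_tables E by blast
    fix u v
    assume eq: "\<And>f. f \<in> ?F \<Longrightarrow> eval f u = eval f v" and u: "factor_word gamma {[t, a, a]} u"
    have *: "eval (letters2 t B_c a B_f) u = eval (letters2 t B_c a B_f) v"
      "eval (letters2 a B_c t B_one) u = eval (letters2 a B_c t B_one) v"
      by (rule eq, simp)+
    show "factor_word gamma {[t, a, a]} v \<and> (u, v) \<in> gamma"
      using u gamma_ta[OF at _ *] * by (simp add: factor_ta[OF at])
  qed (use z in simp_all)
qed

lemma copies_in_M_at:
  fixes U :: "'x::infinite monoid set" and a t :: "'l::countable"
  assumes U: "monoid_variety U" and at: "a \<noteq> t"
  shows "copies_in U (M_monoid gamma (word_classes gamma {[a, a, t]})) \<longleftrightarrow> copies_in U (table_monoid E_op_table)"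
    (is "copies_in U ?M \<longleftrightarrow> _")
proof
  have z: "\<not> factor_word gamma {[a, a, t]} [t, t]"
    by (simp add: factor_at[OF at] letters2_def)
  then show "copies_in U (table_monoid E_op_table)" if "copies_in U ?M"
    by (rule E_op_table_if_M[OF U at that]) simp
  assume E: "copies_in U (table_monoid E_op_table)"
  let ?F = "{letters2 t B_c a B_e, letters2 a B_c t B_one}"
  show "copies_in U ?M"
  proof (rule copies_in_M_if_tables[OF U, where F = ?F])
    show "\<exists>S. range f \<subseteq> S \<and> monoid (table_monoid S) \<and> countable S \<and> copies_in U (table_monoid S)"
      if "f \<in> ?F" for f
      using that letters_E_op_table[of f t a] monoid_tables countable_tables E by blast
    fix u v
    assume eq: "\<And>f. f \<in> ?F \<Longrightarrow> eval f u = eval f v" and u: "factor_word gamma {[a, a, t]} u"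
    have *: "eval (letters2 t B_c a B_e) u = eval (letters2 t B_c a B_e) v"
      "eval (letters2 a B_c t B_one) u = eval (letters2 a B_c t B_one) v"
      by (rule eq, simp)+
    show "factor_word gamma {[a, a, t]} v \<and> (u, v) \<in> gamma"
      using u gamma_at[OF at _ *] * by (simp add: factor_at[OF at])
  qed (use z in simp_all)
qed

text \<open>For a factor \<open>u\<close> at least one of the two tests is nonzero, and that test
  decides between \<open>gamma_ta\<close> and \<open>gamma_at\<close>.\<close>

lemma copies_in_M_ta_at:
  fixes U :: "'x::infinite monoid set" and a t :: "'l::countable"
  assumes U: "monoid_variety U" and at: "a \<noteq> t"
  shows "copies_in U (M_monoid gamma (word_classes gamma {[t, a, a], [a, a, t]})) \<longleftrightarrow>
    copies_in U (table_monoid E_table) \<and> copies_in U (table_monoid E_op_table)"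
    (is "copies_in U ?M \<longleftrightarrow> _")
proof (intro iffI conjI)
  let ?W = "{[t, a, a], [a, a, t]}"
  have factor: "factor_word gamma ?W u \<longleftrightarrow>
      eval (letters2 t B_c a B_f) u \<noteq> B_zero \<or> eval (letters2 t B_c a B_e) u \<noteq> B_zero" for u
    by (simp add: factor_word_insert[of _ _ "{[a, a, t]}"] factor_ta[OF at] factor_at[OF at])
  then have z: "\<not> factor_word gamma ?W [t, t]"
    by (simp add: letters2_def)
  show "copies_in U (table_monoid E_table)" if "copies_in U ?M"
    by (rule E_table_if_M[OF U at that z]) (auto simp: factor_word_def)
  show "copies_in U (table_monoid E_op_table)" if "copies_in U ?M"
    by (rule E_op_table_if_M[OF U at that z]) (auto simp: factor_word_def)
  assume E: "copies_in U (table_monoid E_table) \<and> copies_in U (table_monoid E_op_table)"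
  let ?F = "{letters2 t B_c a B_f, letters2 t B_c a B_e, letters2 a B_c t B_one}"
  show "copies_in U ?M"
  proof (rule copies_in_M_if_tables[OF U, where F = ?F])
    show "\<exists>S. range f \<subseteq> S \<and> monoid (table_monoid S) \<and> countable S \<and> copies_in U (table_monoid S)"
      if "f \<in> ?F" for f
      using that letters_E_table[of f t a] letters_E_op_table[of f t a] monoid_tables countable_tables E by blast
    fix u v
    assume eq: "\<And>f. f \<in> ?F \<Longrightarrow> eval f u = eval f v" and u: "factor_word gamma ?W u"
    have *: "eval (letters2 t B_c a B_f) u = eval (letters2 t B_c a B_f) v"
      "eval (letters2 t B_c a B_e) u = eval (letters2 t B_c a B_e) v"
      "eval (letters2 a B_c t B_one) u = eval (letters2 a B_c t B_one) v"
      by (rule eq, simp)+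
    show "factor_word gamma ?W v \<and> (u, v) \<in> gamma"
      using u gamma_ta[OF at _ *(1,3)] gamma_at[OF at _ *(2,3)] * by (auto simp: factor)
  qed (use z in simp_all)
qed

text \<open>The assignment \<open>?t\<close> has values in both tables and recognizes factors. A
  factor that is a factor of ta^+ or a^+t is handled as for these classes; all others form one class
  of \<open>gamma\<close>.\<close>

lemma copies_in_M_ata:
  fixes U :: "'x::infinite monoid set" and a t :: "'l::countable"
  assumes U: "monoid_variety U" and at: "a \<noteq> t"
  shows "copies_in U (M_monoid gamma (word_classes gamma {[a, t, a]})) \<longleftrightarrow>
    copies_in U (table_monoid E_table) \<and> copies_in U (table_monoid E_op_table)"
    (is "copies_in U ?M \<longleftrightarrow> _")
proof (intro iffI conjI)
  let ?ft = "letters2 t B_c a B_f" and ?et = "letters2 t B_c a B_e"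
    and ?a = "letters2 a B_c t B_one" and ?t = "letters2 t B_c a B_one"
  have z: "\<not> factor_word gamma {[a, t, a]} [t, t]"
    by (simp add: factor_ata[OF at] letters2_def)
  have "eval ?t u \<noteq> B_zero" if "eval ?ft u \<noteq> B_zero" for u
    using form_ta[OF at that] at by (auto simp: letters2_def)
  then show "copies_in U (table_monoid E_table)" if "copies_in U ?M"
    by (intro E_table_if_M[OF U at that z]) (simp add: factor_ta[OF at] factor_ata[OF at])
  have "eval ?t u \<noteq> B_zero" if "eval ?et u \<noteq> B_zero" for u
    using form_at[OF at that] at by (auto simp: letters2_def)
  then show "copies_in U (table_monoid E_op_table)" if "copies_in U ?M"
    by (intro E_op_table_if_M[OF U at that z]) (simp add: factor_at[OF at] factor_ata[OF at])
  assume E: "copies_in U (table_monoid E_table) \<and> copies_in U (table_monoid E_op_table)"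
  let ?F = "{?ft, ?et, ?a, ?t}"
  show "copies_in U ?M"
  proof (rule copies_in_M_if_tables[OF U, where F = ?F])
    show "\<exists>S. range f \<subseteq> S \<and> monoid (table_monoid S) \<and> countable S \<and> copies_in U (table_monoid S)"
      if "f \<in> ?F" for f
      using that letters_E_table[of f t a] letters_E_op_table[of f t a] monoid_tables countable_tables E by blast
    fix u v
    assume eq: "\<And>f. f \<in> ?F \<Longrightarrow> eval f u = eval f v" and u: "factor_word gamma {[a, t, a]} u"
    have *: "eval ?ft u = eval ?ft v" "eval ?et u = eval ?et v" "eval ?a u = eval ?a v" "eval ?t u = eval ?t v"
      by (rule eq, simp)+
    have uv: "eval ?t u \<noteq> B_zero" "eval ?t v \<noteq> B_zero"
      using u *(4) by (simp_all add: factor_ata[OF at])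
    have "(u, v) \<in> gamma"
    proof (cases "eval ?ft u = B_zero \<and> eval ?et u = B_zero")
      case True
      \<comment> \<open>For a^m t a^n the value under \<open>?ft\<close> vanishes iff m > 0 and that
        under \<open>?et\<close> iff n > 0, whereas a word without \<open>t\<close> survives
        both.\<close>
      have pos: "\<exists>m n. 0 < m \<and> 0 < n \<and> w = replicate m a @ t # replicate n a"
        if w: "eval ?ft w = B_zero" "eval ?et w = B_zero" "eval ?t w \<noteq> B_zero" for w
      proof -
        obtain m n where "w = replicate m a \<or> w = replicate m a @ t # replicate n a"
          using form_ata[OF at w(3)] by blast
        with w(1,2) at show ?thesis
          by (auto simp: letters2_def split: if_splits)
      qed
      obtain m n where "0 < m" "0 < n" "u = replicate m a @ t # replicate n a"
        using pos True uv by blast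
      moreover obtain m' n' where "0 < m'" "0 < n'" "v = replicate m' a @ t # replicate n' a"
        using pos True uv *(1,2) by metis
      ultimately show ?thesis
        using gamma_ata[OF at] by blast
    next
      case False
      then show ?thesis
        using gamma_ta[OF at _ *(1,3)] gamma_at[OF at _ *(2,3)] by blast
    qed
    with uv show "factor_word gamma {[a, t, a]} v \<and> (u, v) \<in> gamma"
      by (simp add: factor_ata[OF at])
  qed (use z in simp_all)
qed

text \<open>The order of the letters is tested by \<open>?ab\<close>; the two exponents are counted
  separately by \<open>A_fe\<close>, the other letter being sent to the identity. The word
  \<open>[b, a]\<close> reaches zero since e f = 0.\<close>

lemma copies_in_M_ab:
  fixes U :: "'x::infinite monoid set" and a b :: "'l::countable"
  assumes U: "monoid_variety U" and ab: "a \<noteq> b"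
  shows "copies_in U (M_monoid gamma (word_classes gamma {[a, a, b, b]})) \<longleftrightarrow>
    copies_in U (table_monoid (UNIV :: a0_table set))"
    (is "copies_in U ?M \<longleftrightarrow> _")
proof
  let ?ab = "letters2 a A_f b A_e" and ?a = "letters2 a A_fe b A_one" and ?b = "letters2 b A_fe a A_one"
  have z: "\<not> factor_word gamma {[a, a, b, b]} [b, a]"
    using ab by (simp add: factor_ab[OF ab] letters2_def)
  show "copies_in U (table_monoid (UNIV :: a0_table set))" if M: "copies_in U ?M"
  proof (rule copies_in_table_if_M[OF U M z, where f = ?ab])
    show "eval ?ab u \<noteq> 0 \<Longrightarrow> factor_word gamma {[a, a, b, b]} u" for u
      by (simp add: factor_ab[OF ab])
    have "A_one = eval ?ab []" "A_f = eval ?ab [a]" "A_e = eval ?ab [b]" "A_fe = eval ?ab [a, b]"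
      "A_zero = eval ?ab [b, a]"
      using ab by (simp_all add: letters2_def)
    then show "UNIV \<subseteq> range (eval ?ab)"
      unfolding UNIV_a0_table by blast
  qed (rule letters2_gamma monoid_tables | simp)+
  assume A: "copies_in U (table_monoid (UNIV :: a0_table set))"
  let ?F = "{?ab, ?a, ?b}"
  show "copies_in U ?M"
  proof (rule copies_in_M_if_tables[OF U, where F = ?F])
    show "\<exists>S. range f \<subseteq> S \<and> monoid (table_monoid S) \<and> countable S \<and> copies_in U (table_monoid S)"
      for f :: "'l \<Rightarrow> a0_table"
      using monoid_tables(3) countable_tables A by blast
    fix u v
    assume eq: "\<And>f. f \<in> ?F \<Longrightarrow> eval f u = eval f v" and u: "factor_word gamma {[a, a, b, b]} u"
    have *: "eval ?ab u = eval ?ab v" "eval ?a u = eval ?a v" "eval ?b u = eval ?b v"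
      by (rule eq, simp)+
    have uv: "eval ?ab u \<noteq> A_zero" "eval ?ab v \<noteq> A_zero"
      using u *(1) by (simp_all add: factor_ab[OF ab])
    obtain m n m' n' where forms: "u = replicate m a @ replicate n b" "v = replicate m' a @ replicate n' b"
      using form_ab[OF ab uv(1)] form_ab[OF ab uv(2)] by blast
    have "min 2 m = min 2 m'"
      using *(2) ab by (auto simp: forms letters2_def split: if_splits)
    moreover have "min 2 n = min 2 n'"
      using *(3) ab by (auto simp: forms letters2_def split: if_splits)
    ultimately have "(u, v) \<in> gamma"
      unfolding forms by (intro gamma_append gamma_replicate)
    with uv show "factor_word gamma {[a, a, b, b]} v \<and> (u, v) \<in> gamma"
      by (simp add: factor_ab[OF ab])
  qed (use z in simp_all)
qed

section \<open>Representatives of the classes in the theorem\<close>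

lemma class_mult_gamma_class:
  "class_mult gamma (gamma `` {u}) (gamma `` {v}) = gamma `` {u @ v}"
  by (rule class_mult_class[OF word_congruence_gamma])

text \<open>The normal form forces a power of \<open>x\<close>, and the capped count forces the
  exponent 1.\<close>

lemma class_letter_gamma: "class_letter x = gamma `` {[x]}"
proof -
  have "u = [x]" if "([x], u) \<in> gamma" for u
  proof -
    have "remdups_adj u = [x]"
      using that by (simp add: gamma_iff)
    moreover have "min 2 (count_list [x] x) = min 2 (count_list u x)"
      using that unfolding gamma_iff by blast
    ultimately have "u = replicate (length u) x" "count_list u x = 1"
      using remdups_adj_singleton by (fastforce, simp add: min_def split: if_splits)
    then show ?thesis
      by (metis One_nat_def count_list_replicate replicate_0 replicate_Suc)
  qed
  then show ?thesis
    using gamma_refl by (auto simp: class_letter_def)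
qed

lemma class_plus_gamma: "class_plus x = gamma `` {[x, x]}"
proof -
  have "\<exists>n\<ge>2. u = replicate n x" if "([x, x], u) \<in> gamma" for u
  proof -
    have "remdups_adj u = [x]"
      using that by (simp add: gamma_iff)
    moreover have "min 2 (count_list [x, x] x) = min 2 (count_list u x)"
      using that unfolding gamma_iff by blast
    ultimately have "u = replicate (length u) x" "2 \<le> count_list u x"
      using remdups_adj_singleton by (fastforce, simp add: min_def split: if_splits)
    then show ?thesis
      by (metis count_list_replicate)
  qed
  moreover have "([x, x], replicate n x) \<in> gamma" if "2 \<le> n" for n
    using gamma_replicate[of 2 n x] that by (simp add: numeral_2_eq_2)
  ultimately show ?thesis
    by (auto simp: class_plus_def)
qed

text \<open>Multiplying the classes gives the longer representative; the factor lemmas use the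
  shorter one.\<close>

lemma gamma_class_ata: "a \<noteq> t \<Longrightarrow> gamma `` {[a, a, t, a, a]} = gamma `` {[a, t, a]}"
  using gamma_ata[of a t 2 2 1 1]
  by (simp add: word_congruence_class_eq_iff[OF word_congruence_gamma] numeral_2_eq_2)

theorem theorem4p1:
  fixes a b t :: "'l::{countable, infinite}"
  assumes "distinct [a, b, t]"
  shows
    "(variety_E :: 'x::infinite monoid set)
        = variety_M gamma {class_letter t \<cdot>\<^sub>\<gamma> class_plus a}
     \<and>
     dual_variety (variety_E :: 'x monoid set)
        = variety_M gamma {class_plus a \<cdot>\<^sub>\<gamma> class_letter t}
     \<and>
     (variety_join variety_E (dual_variety variety_E) = (variety_B0 :: 'x monoid set)
      \<and> (variety_B0 :: 'x monoid set)
        = variety_M gamma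
            {class_letter t \<cdot>\<^sub>\<gamma> class_plus a, class_plus a \<cdot>\<^sub>\<gamma> class_letter t}
      \<and> (variety_M gamma
            {class_letter t \<cdot>\<^sub>\<gamma> class_plus a, class_plus a \<cdot>\<^sub>\<gamma> class_letter t}
            :: 'x monoid set)
        = variety_M gamma {class_plus a \<cdot>\<^sub>\<gamma> class_letter t \<cdot>\<^sub>\<gamma> class_plus a})
     \<and>
     (variety_A0 :: 'x monoid set)
        = variety_M gamma {class_plus a \<cdot>\<^sub>\<gamma> class_plus b}"
proof -
  have at: "a \<noteq> t" and ab: "a \<noteq> b" using assms by auto
  have W: "{class_letter t \<cdot>\<^sub>\<gamma> class_plus a} = word_classes gamma {[t, a, a]}"
    "{class_plus a \<cdot>\<^sub>\<gamma> class_letter t} = word_classes gamma {[a, a, t]}"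
    "{class_letter t \<cdot>\<^sub>\<gamma> class_plus a, class_plus a \<cdot>\<^sub>\<gamma> class_letter t}
      = word_classes gamma {[t, a, a], [a, a, t]}"
    "{class_plus a \<cdot>\<^sub>\<gamma> class_letter t \<cdot>\<^sub>\<gamma> class_plus a} = word_classes gamma {[a, t, a]}"
    "{class_plus a \<cdot>\<^sub>\<gamma> class_plus b} = word_classes gamma {[a, a, b, b]}"
    by (simp_all add: class_letter_gamma class_plus_gamma class_mult_gamma_class word_classes_def
        gamma_class_ata[OF at])
  \<comment> \<open>The opposite of E^1 reaches \<open>E_op_table\<close> by two isomorphisms,
    through the opposite of \<open>E_table\<close>.\<close>
  have E: "copies_in U (adjoin_one semigroup_E) \<longleftrightarrow> copies_in U (table_monoid E_table)"
    and E_op: "copies_in U (opposite_monoid (adjoin_one semigroup_E)) \<longleftrightarrow> copies_in U (table_monoid E_op_table)"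
    and B0: "copies_in U (adjoin_one semigroup_B0) \<longleftrightarrow> copies_in U (table_monoid (UNIV :: b0_table set))"
    and A0: "copies_in U (adjoin_one semigroup_A0) \<longleftrightarrow> copies_in U (table_monoid (UNIV :: a0_table set))"
    for U :: "'x monoid set"
    using copies_in_iso[OF monoid_tables(1) adjoin_one_semigroup_E]
      copies_in_iso[OF monoid_opposite[OF monoid_tables(1)] is_iso_opposite[OF adjoin_one_semigroup_E]]
      copies_in_iso[OF monoid_opposite[OF monoid_tables(1)] opposite_E_table]
      copies_in_iso[OF monoid_tables(3) adjoin_one_semigroup_B0]
      copies_in_iso[OF monoid_tables(3) adjoin_one_semigroup_A0] by blast+
  have dual: "dual_variety variety_E = (generated_variety (opposite_monoid (adjoin_one semigroup_E)) :: 'x monoid set)"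
    unfolding variety_E_def by (rule dual_generated_variety)
  have "(variety_E :: 'x monoid set) = variety_M gamma (word_classes gamma {[t, a, a]})"
    unfolding variety_E_def variety_M_def
    by (rule generated_variety_cong) (simp add: E copies_in_M_ta[OF _ at])
  moreover have "dual_variety (variety_E :: 'x monoid set) = variety_M gamma (word_classes gamma {[a, a, t]})"
    unfolding dual variety_M_def
    by (rule generated_variety_cong) (simp add: E_op copies_in_M_at[OF _ at])
  moreover have "variety_join variety_E (dual_variety variety_E) = (variety_B0 :: 'x monoid set)"
    unfolding dual unfolding variety_E_def variety_B0_def
    by (rule variety_join_generated) (simp add: E E_op B0 copies_in_B0_table)
  moreover have "(variety_B0 :: 'x monoid set) = variety_M gamma (word_classes gamma {[t, a, a], [a, a, t]})"
    unfolding variety_B0_def variety_M_def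
    by (rule generated_variety_cong) (simp add: B0 copies_in_B0_table copies_in_M_ta_at[OF _ at])
  moreover have "(variety_M gamma (word_classes gamma {[t, a, a], [a, a, t]}) :: 'x monoid set)
      = variety_M gamma (word_classes gamma {[a, t, a]})"
    unfolding variety_M_def
    by (rule generated_variety_cong) (simp add: copies_in_M_ta_at[OF _ at] copies_in_M_ata[OF _ at])
  moreover have "(variety_A0 :: 'x monoid set) = variety_M gamma (word_classes gamma {[a, a, b, b]})"
    unfolding variety_A0_def variety_M_def
    by (rule generated_variety_cong) (simp add: A0 copies_in_M_ab[OF _ ab])
  ultimately show ?thesis
    unfolding W(3) unfolding W(1,2,4,5) by blast
qed

end
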